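(* Let $\mathbf{A}$ be a unital $\mathrm{C}^*$-algebra with a c.e. presentation $\mathbf{A}^\#$, and let $E\subseteq\mathbf{A}^N$ be the set of tuples satisfying a computably weakly stable set of relations $\mathcal{R}$ in $N$ variables. Then $E$ is a c.e.-closed subset of $(\mathbf{A}^\#)^N$.
   Context: A presentation $\mathbf{A}^\#$ of $\mathbf{A}$ is a sequence in $\mathbf{A}$ (special points) generating a dense $*$-subalgebra; rational points are $*$-polynomials with $\mathbb{Q}(i)$ coefficients and no constant term in special points, effectively enumerated. $\mathbf{A}^\#$ is c.e. if an algorithm, given a rational point $q$, enumerates a decreasing sequence of rationals converging to $\|q\|$. $(\mathbf{A}^\#)^N$ is the presentation of $\mathbf{A}^N$ (max norm) whose special points are the $N$-tuples of rational points of $\mathbf{A}^\#$ (enumerated via a computable bijection with $\mathbb{N}$). A rational open ball is an open ball with rational radius centered at a rational point. A closed set $C$ is c.e.-closed for a presentation if the set of rational open balls intersecting $C$ is c.e. A set of relations in variables $\vec x=(x_1,\ldots,x_N)$ is $\mathcal{R}=\{p_i(\vec x)=0: i=1,\ldots,M\}\cup\{\|x_j\|\le C_j: j=1,\ldots,N\}$ with $p_i$ $*$-polynomials with rational coefficients and $C_j\in\mathbb{N}$; for $\vec w$ in a $\mathrm{C}^*$-algebra $\mathbf{B}$, $\mathcal{R}^{\mathbf{B}}(\vec w)=\max(\{\|p_i(\vec w)\|\}\cup\{\|w_j\|-C_j\})$, and $\mathbf{B}\models\mathcal{R}(\vec w)$ means all relations hold. A function $g:\mathbb{N}\to\mathbb{N}$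 is a modulus of weak stability for $\mathcal{R}$ if for every $k$, every $\mathrm{C}^*$-algebra $\mathbf{B}$ and every $\vec w\in\mathbf{B}^N$ with $\mathcal{R}^{\mathbf{B}}(\vec w)<2^{-g(k)}$, there is $\vec z\in\mathbf{B}^N$ with $\max_j\|w_j-z_j\|<2^{-k}$ and $\mathbf{B}\models\mathcal{R}(\vec z)$; $\mathcal{R}$ is computably weakly stable if it has a computable modulus of weak stability. *)

theory Defs
  imports
    "HOL-Analysis.Abstract_Metric_Spaces"
    "HOL-Algebra.Module"
    "HOL-Library.Poly_Mapping"
    "HOL-Library.Nat_Bijection"
    "HOL-Library.FuncSet"
begin

section \<open>Computability\<close>

text \<open>
  The \<^emph>\<open>total\<close> recursive functions: minimisation is only applied to regular functions. By
  Kleene's normal form theorem this yields exactly the total computable functions. An argument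
  list of a length other than the stated arity is meaningless.
\<close>

inductive recursive :: "nat \<Rightarrow> (nat list \<Rightarrow> nat) \<Rightarrow> bool" where
  zero: "recursive n (\<lambda>xs. 0)"
| succ: "recursive 1 (\<lambda>xs. Suc (hd xs))"
| proj: "i < n \<Longrightarrow> recursive n (\<lambda>xs. xs ! i)"
| comp: "\<lbrakk>recursive m f; length gs = m; \<forall>g\<in>set gs. recursive n g\<rbrakk>
    \<Longrightarrow> recursive n (\<lambda>xs. f (map (\<lambda>g. g xs) gs))"
| prim: "\<lbrakk>recursive n f; recursive (Suc (Suc n)) g\<rbrakk>
    \<Longrightarrow> recursive (Suc n) (\<lambda>xs. rec_nat (f (tl xs)) (\<lambda>k r. g (k # r # tl xs)) (hd xs))"
| mu: "\<lbrakk>recursive (Suc n) f; \<forall>xs. length xs = n \<longrightarrow> (\<exists>k. f (k # xs) = 0)\<rbrakk>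
    \<Longrightarrow> recursive n (\<lambda>xs. LEAST k. f (k # xs) = 0)"

definition computable :: "(nat \<Rightarrow> nat) \<Rightarrow> bool" where
  "computable h \<longleftrightarrow> (\<exists>f. recursive 1 f \<and> (\<forall>x. h x = f [x]))"

definition computable2 :: "(nat \<Rightarrow> nat \<Rightarrow> nat) \<Rightarrow> bool" where
  "computable2 h \<longleftrightarrow> (\<exists>f. recursive 2 f \<and> (\<forall>x y. h x y = f [x, y]))"

definition ce_set :: "nat set \<Rightarrow> bool" where
  "ce_set X \<longleftrightarrow> X = {} \<or> (\<exists>h. computable h \<and> X = range h)"


section \<open>C*-algebras\<close>

definition complex_ring :: "complex ring" where
  "complex_ring = \<lparr>carrier = UNIV, mult = (*), one = 1, zero = 0, add = (+)\<rparr>"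

text \<open>
  The record field \<^const>\<open>one\<close>, inherited from \<open>ring\<close>, is unconstrained in a general
  C*-algebra \<open>B\<close>; the algebra is unital, with unit \<open>\<one>\<^bsub>B\<^esub>\<close>, precisely if
  \<open>Group.monoid B\<close> holds.
\<close>

record 'a cstar = "(complex, 'a) module" +
  star :: "'a \<Rightarrow> 'a"
  cnorm :: "'a \<Rightarrow> real"

text \<open>
  Outside the carrier the distance is set to 0, because \<^locale>\<open>Metric_space\<close> requires
  symmetry and nonnegativity on the whole type.
\<close>

definition cdist :: "('a, 'm) cstar_scheme \<Rightarrow> 'a \<Rightarrow> 'a \<Rightarrow> real" where
  "cdist B x y =
    (if x \<in> carrier B \<and> y \<in> carrier B then cnorm B (x \<ominus>\<^bsub>B\<^esub> y) else 0)"

locale cstar_algebra = Module.module complex_ring B for B :: "('a, 'm) cstar_scheme" (structure) +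
  assumes mult_closed: "\<lbrakk>x \<in> carrier B; y \<in> carrier B\<rbrakk> \<Longrightarrow> x \<otimes> y \<in> carrier B"
    and mult_assoc: "\<lbrakk>x \<in> carrier B; y \<in> carrier B; z \<in> carrier B\<rbrakk>
      \<Longrightarrow> (x \<otimes> y) \<otimes> z = x \<otimes> (y \<otimes> z)"
    and mult_l_distr: "\<lbrakk>x \<in> carrier B; y \<in> carrier B; z \<in> carrier B\<rbrakk>
      \<Longrightarrow> (x \<oplus> y) \<otimes> z = x \<otimes> z \<oplus> y \<otimes> z"
    and mult_r_distr: "\<lbrakk>x \<in> carrier B; y \<in> carrier B; z \<in> carrier B\<rbrakk>
      \<Longrightarrow> z \<otimes> (x \<oplus> y) = z \<otimes> x \<oplus> z \<otimes> y"
    and mult_smult_l: "\<lbrakk>x \<in> carrier B; y \<in> carrier B\<rbrakk> \<Longrightarrow> (c \<odot> x) \<otimes> y = c \<odot> (x \<otimes> y)"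
    and mult_smult_r: "\<lbrakk>x \<in> carrier B; y \<in> carrier B\<rbrakk> \<Longrightarrow> x \<otimes> (c \<odot> y) = c \<odot> (x \<otimes> y)"
    and star_closed: "x \<in> carrier B \<Longrightarrow> star B x \<in> carrier B"
    and star_star: "x \<in> carrier B \<Longrightarrow> star B (star B x) = x"
    and star_add: "\<lbrakk>x \<in> carrier B; y \<in> carrier B\<rbrakk>
      \<Longrightarrow> star B (x \<oplus> y) = star B x \<oplus> star B y"
    and star_smult: "x \<in> carrier B \<Longrightarrow> star B (c \<odot> x) = cnj c \<odot> star B x"
    and star_mult: "\<lbrakk>x \<in> carrier B; y \<in> carrier B\<rbrakk>
      \<Longrightarrow> star B (x \<otimes> y) = star B y \<otimes> star B x"
    and cnorm_nonneg: "x \<in> carrier B \<Longrightarrow> 0 \<le> cnorm B x"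
    and cnorm_eq_0_iff: "x \<in> carrier B \<Longrightarrow> cnorm B x = 0 \<longleftrightarrow> x = \<zero>"
    and cnorm_triangle: "\<lbrakk>x \<in> carrier B; y \<in> carrier B\<rbrakk>
      \<Longrightarrow> cnorm B (x \<oplus> y) \<le> cnorm B x + cnorm B y"
    and cnorm_smult: "x \<in> carrier B \<Longrightarrow> cnorm B (c \<odot> x) = cmod c * cnorm B x"
    and cnorm_mult: "\<lbrakk>x \<in> carrier B; y \<in> carrier B\<rbrakk>
      \<Longrightarrow> cnorm B (x \<otimes> y) \<le> cnorm B x * cnorm B y"
    and cstar_identity: "x \<in> carrier B \<Longrightarrow> cnorm B (star B x \<otimes> x) = (cnorm B x)\<^sup>2"
    and complete: "Metric_space.mcomplete (carrier B) (cdist B)"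

definition power_algebra :: "('a, 'm) cstar_scheme \<Rightarrow> nat \<Rightarrow> (nat \<Rightarrow> 'a) cstar" where
  "power_algebra B N =
    \<lparr>carrier = {..<N} \<rightarrow>\<^sub>E carrier B,
     mult = (\<lambda>x y. \<lambda>j\<in>{..<N}. x j \<otimes>\<^bsub>B\<^esub> y j),
     one = (\<lambda>j\<in>{..<N}. \<one>\<^bsub>B\<^esub>),
     zero = (\<lambda>j\<in>{..<N}. \<zero>\<^bsub>B\<^esub>),
     add = (\<lambda>x y. \<lambda>j\<in>{..<N}. x j \<oplus>\<^bsub>B\<^esub> y j),
     smult = (\<lambda>c x. \<lambda>j\<in>{..<N}. c \<odot>\<^bsub>B\<^esub> x j),
     star = (\<lambda>x. \<lambda>j\<in>{..<N}. star B (x j)),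
     cnorm = (\<lambda>x. Max ((\<lambda>j. cnorm B (x j)) ` {..<N}))\<rparr>"


section \<open>*-polynomials\<close>

text \<open>
  A letter \<open>(j, b)\<close> is the variable \<open>x\<^sub>j\<close> if \<open>b\<close> is false and its adjoint if \<open>b\<close> is true.
  A *-polynomial is a finitely supported combination of words in these letters; its constant
  term is the coefficient of the empty word.
\<close>

type_synonym star_poly = "(nat \<times> bool) list \<Rightarrow>\<^sub>0 complex"

definition gaussian_rationals :: "complex set" where
  "gaussian_rationals = {c. Re c \<in> \<rat> \<and> Im c \<in> \<rat>}"

definition rational_poly :: "star_poly \<Rightarrow> bool" where
  "rational_poly p \<longleftrightarrow> range (Poly_Mapping.lookup p) \<subseteq> gaussian_rationals"

definition poly_vars :: "star_poly \<Rightarrow> nat set" where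
  "poly_vars p = (\<Union>u\<in>Poly_Mapping.keys p. fst ` set u)"

fun letter_val :: "('a, 'm) cstar_scheme \<Rightarrow> (nat \<Rightarrow> 'a) \<Rightarrow> nat \<times> bool \<Rightarrow> 'a" where
  "letter_val B v (j, b) = (if b then star B (v j) else v j)"

text \<open>The unit is involved only in the value of the empty word.\<close>

fun word_val :: "('a, 'm) cstar_scheme \<Rightarrow> (nat \<Rightarrow> 'a) \<Rightarrow> (nat \<times> bool) list \<Rightarrow> 'a" where
  "word_val B v [] = \<one>\<^bsub>B\<^esub>"
| "word_val B v [l] = letter_val B v l"
| "word_val B v (l # l' # ls) = letter_val B v l \<otimes>\<^bsub>B\<^esub> word_val B v (l' # ls)"

definition poly_val :: "('a, 'm) cstar_scheme \<Rightarrow> (nat \<Rightarrow> 'a) \<Rightarrow> star_poly \<Rightarrow> 'a" where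
  "poly_val B v p = (\<Oplus>\<^bsub>B\<^esub>u\<in>Poly_Mapping.keys p. Poly_Mapping.lookup p u \<odot>\<^bsub>B\<^esub> word_val B v u)"


section \<open>An effective enumeration of the rational *-polynomials without constant term\<close>

definition rat_decode :: "nat \<Rightarrow> rat" where
  "rat_decode n = (case prod_decode n of (a, d) \<Rightarrow> of_int (int_decode a) / of_nat (Suc d))"

definition gaussian_decode :: "nat \<Rightarrow> complex" where
  "gaussian_decode n =
    (case prod_decode n of (a, b) \<Rightarrow> Complex (of_rat (rat_decode a)) (of_rat (rat_decode b)))"

definition letter_decode :: "nat \<Rightarrow> nat \<times> bool" where
  "letter_decode n = (n div 2, odd n)"

definition word_decode :: "nat \<Rightarrow> (nat \<times> bool) list" where
  "word_decode n = (case prod_decode n of (l, w) \<Rightarrow> map letter_decode (l # list_decode w))"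

definition monomial_decode :: "nat \<Rightarrow> star_poly" where
  "monomial_decode n =
    (case prod_decode n of (c, w) \<Rightarrow> Poly_Mapping.single (word_decode w) (gaussian_decode c))"

definition poly_decode :: "nat \<Rightarrow> star_poly" where
  "poly_decode n = sum_list (map monomial_decode (list_decode n))"

lemma range_rat_decode: "range rat_decode = UNIV"
proof -
  have "\<exists>n. q = rat_decode n" for q
  proof -
    obtain a b where q: "q = Fract a b" "b > 0"
      by (cases q) auto
    have "q = rat_decode (prod_encode (int_encode a, nat b - 1))"
      using q by (simp add: rat_decode_def Fract_of_int_quotient)
    then show ?thesis ..
  qed
  then show ?thesis by auto
qed

lemma range_gaussian_decode: "range gaussian_decode = gaussian_rationals"
proof
  show "range gaussian_decode \<subseteq> gaussian_rationals"
    by (auto simp: gaussian_decode_def gaussian_rationals_def split: prod.splits)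
  show "gaussian_rationals \<subseteq> range gaussian_decode"
  proof
    fix c assume "c \<in> gaussian_rationals"
    then obtain p q where pq: "Re c = of_rat p" "Im c = of_rat q"
      by (auto simp: gaussian_rationals_def elim!: Rats_cases)
    obtain a b where "rat_decode a = p" "rat_decode b = q"
      using range_rat_decode by (metis UNIV_I imageE)
    with pq have "c = gaussian_decode (prod_encode (a, b))"
      by (simp add: gaussian_decode_def complex_eq_iff)
    then show "c \<in> range gaussian_decode" by (rule range_eqI)
  qed
qed

lemma word_decode_surj:
  assumes "u \<noteq> []"
  shows "\<exists>w. word_decode w = u"
proof -
  have surj: "\<exists>n. letter_decode n = l" for l
  proof (cases l)
    case (Pair j b)
    then have "letter_decode (2 * j + of_bool b) = l"
      by (auto simp: letter_decode_def)
    then show ?thesis ..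
  qed
  obtain h where h: "\<And>l. letter_decode (h l) = l"
    using surj by metis
  obtain l ls where u: "u = l # ls"
    using assms by (cases u) auto
  have "word_decode (prod_encode (h l, list_encode (map h ls))) = u"
    by (simp add: word_decode_def u h comp_def)
  then show ?thesis ..
qed

lemma range_poly_decode: "range poly_decode = {p. rational_poly p \<and> Poly_Mapping.lookup p [] = 0}"
proof
  have mono: "Poly_Mapping.lookup (monomial_decode m) [] = 0"
      "Poly_Mapping.lookup (monomial_decode m) u \<in> gaussian_rationals" for m u
    using range_gaussian_decode
    by (auto simp: monomial_decode_def word_decode_def lookup_single when_def
        gaussian_rationals_def split: prod.splits)
  have "Poly_Mapping.lookup (sum_list (map monomial_decode ms)) [] = 0 \<and>
      Poly_Mapping.lookup (sum_list (map monomial_decode ms)) u \<in> gaussian_rationals" for ms u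
  proof (induction ms)
    case (Cons m ms)
    then show ?case using mono[of m] mono(2)[of m u]
      by (auto simp: lookup_add gaussian_rationals_def)
  qed (simp add: gaussian_rationals_def)
  then show "range poly_decode \<subseteq> {p. rational_poly p \<and> Poly_Mapping.lookup p [] = 0}"
    by (auto simp: poly_decode_def rational_poly_def)
  have "\<exists>n. poly_decode n = p" if "rational_poly p" "Poly_Mapping.lookup p [] = 0" for p
  proof -
    have "\<exists>m. monomial_decode m = Poly_Mapping.single u (Poly_Mapping.lookup p u)"
      if "u \<in> Poly_Mapping.keys p" for u
    proof -
      have "u \<noteq> []"
        using that \<open>Poly_Mapping.lookup p [] = 0\<close> by (auto simp: in_keys_iff)
      then obtain w where "word_decode w = u"
        using word_decode_surj by blast
      moreover have "Poly_Mapping.lookup p u \<in> range gaussian_decode"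
        using \<open>rational_poly p\<close> by (auto simp: rational_poly_def range_gaussian_decode)
      then obtain c where "gaussian_decode c = Poly_Mapping.lookup p u"
        by (rule rangeE) simp
      ultimately have "monomial_decode (prod_encode (c, w)) = Poly_Mapping.single u (Poly_Mapping.lookup p u)"
        by (simp add: monomial_decode_def)
      then show ?thesis ..
    qed
    then have "\<forall>u\<in>Poly_Mapping.keys p.
        \<exists>m. monomial_decode m = Poly_Mapping.single u (Poly_Mapping.lookup p u)"
      by (rule ballI)
    from bchoice[OF this] obtain h where h: "\<forall>u\<in>Poly_Mapping.keys p.
        monomial_decode (h u) = Poly_Mapping.single u (Poly_Mapping.lookup p u)"
      by (rule exE)
    obtain us where us: "set us = Poly_Mapping.keys p" "distinct us"
      using finite_distinct_list[OF finite_keys[of p]] by auto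
    have "map monomial_decode (map h us) =
        map (\<lambda>u. Poly_Mapping.single u (Poly_Mapping.lookup p u)) us"
      using h us(1) by simp
    then have "poly_decode (list_encode (map h us)) =
        (\<Sum>u\<leftarrow>us. Poly_Mapping.single u (Poly_Mapping.lookup p u))"
      unfolding poly_decode_def list_encode_inverse by (rule arg_cong)
    also have "\<dots> = (\<Sum>u\<in>Poly_Mapping.keys p. Poly_Mapping.single u (Poly_Mapping.lookup p u))"
      using us by (simp add: sum_list_distinct_conv_sum_set)
    also have "\<dots> = p"
    proof (rule poly_mapping_eqI)
      fix k
      show "Poly_Mapping.lookup (\<Sum>u\<in>Poly_Mapping.keys p. Poly_Mapping.single u (Poly_Mapping.lookup p u)) k =
          Poly_Mapping.lookup p k"
        by (auto simp: lookup_sum lookup_single when_def in_keys_iff)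
    qed
    finally show ?thesis by blast
  qed
  then show "{p. rational_poly p \<and> Poly_Mapping.lookup p [] = 0} \<subseteq> range poly_decode"
    by blast
qed


section \<open>Presentations\<close>

text \<open>The *-subalgebra generated by a set; it need not contain the unit.\<close>

inductive_set star_subalgebra :: "('a, 'm) cstar_scheme \<Rightarrow> 'a set \<Rightarrow> 'a set"
  for B :: "('a, 'm) cstar_scheme" and S :: "'a set" where
  base: "x \<in> S \<Longrightarrow> x \<in> star_subalgebra B S"
| zero: "\<zero>\<^bsub>B\<^esub> \<in> star_subalgebra B S"
| add: "\<lbrakk>x \<in> star_subalgebra B S; y \<in> star_subalgebra B S\<rbrakk> \<Longrightarrow> x \<oplus>\<^bsub>B\<^esub> y \<in> star_subalgebra B S"
| smult: "x \<in> star_subalgebra B S \<Longrightarrow> c \<odot>\<^bsub>B\<^esub> x \<in> star_subalgebra B S"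
| mult: "\<lbrakk>x \<in> star_subalgebra B S; y \<in> star_subalgebra B S\<rbrakk> \<Longrightarrow> x \<otimes>\<^bsub>B\<^esub> y \<in> star_subalgebra B S"
| star: "x \<in> star_subalgebra B S \<Longrightarrow> star B x \<in> star_subalgebra B S"

text \<open>A presentation is given by its sequence \<open>s\<close> of special points.\<close>

definition presentation :: "('a, 'm) cstar_scheme \<Rightarrow> (nat \<Rightarrow> 'a) \<Rightarrow> bool" where
  "presentation B s \<longleftrightarrow> range s \<subseteq> carrier B \<and>
    Metric_space.mtopology (carrier B) (cdist B) closure_of (star_subalgebra B (range s)) = carrier B"

definition rational_point :: "('a, 'm) cstar_scheme \<Rightarrow> (nat \<Rightarrow> 'a) \<Rightarrow> nat \<Rightarrow> 'a" where
  "rational_point B s n = poly_val B s (poly_decode n)"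

definition ce_presentation :: "('a, 'm) cstar_scheme \<Rightarrow> (nat \<Rightarrow> 'a) \<Rightarrow> bool" where
  "ce_presentation B s \<longleftrightarrow> presentation B s \<and>
    (\<exists>f. computable2 f \<and> (\<forall>n.
      decseq (\<lambda>k. rat_decode (f n k)) \<and>
      (\<lambda>k. real_of_rat (rat_decode (f n k))) \<longlonglongrightarrow> cnorm B (rational_point B s n)))"

text \<open>
  A computable bijection from \<^typ>\<open>nat\<close> onto the \<open>N\<close>-tuples of natural numbers; \<open>e m j\<close> is the
  \<open>j\<close>-th entry of the \<open>m\<close>-th tuple.
\<close>

definition computable_tuple_enum :: "nat \<Rightarrow> (nat \<Rightarrow> nat \<Rightarrow> nat) \<Rightarrow> bool" where
  "computable_tuple_enum N e \<longleftrightarrow>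
    bij_betw (\<lambda>m. \<lambda>j\<in>{..<N}. e m j) UNIV ({..<N} \<rightarrow>\<^sub>E UNIV) \<and> computable2 e"

text \<open>The special points of \<open>(A\<^sup>#)\<^sup>N\<close>: all \<open>N\<close>-tuples of rational points, enumerated along \<open>e\<close>.\<close>

definition power_presentation ::
  "('a, 'm) cstar_scheme \<Rightarrow> (nat \<Rightarrow> 'a) \<Rightarrow> nat \<Rightarrow> (nat \<Rightarrow> nat \<Rightarrow> nat) \<Rightarrow> nat \<Rightarrow> nat \<Rightarrow> 'a" where
  "power_presentation B s N e m = (\<lambda>j\<in>{..<N}. rational_point B s (e m j))"

text \<open>Codes of nonpositive radii describe the empty ball, which meets no set.\<close>

definition rational_ball :: "('a, 'm) cstar_scheme \<Rightarrow> (nat \<Rightarrow> 'a) \<Rightarrow> nat \<Rightarrow> 'a set" where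
  "rational_ball B s i = (case prod_decode i of (n, r) \<Rightarrow>
    Metric_space.mball (carrier B) (cdist B) (rational_point B s n) (real_of_rat (rat_decode r)))"

definition ce_closed :: "('a, 'm) cstar_scheme \<Rightarrow> (nat \<Rightarrow> 'a) \<Rightarrow> 'a set \<Rightarrow> bool" where
  "ce_closed B s X \<longleftrightarrow> closedin (Metric_space.mtopology (carrier B) (cdist B)) X \<and>
    ce_set {i. rational_ball B s i \<inter> X \<noteq> {}}"


section \<open>Relations and weak stability\<close>

text \<open>Only the bounds \<open>bounds R j\<close> with \<open>j < nvars R\<close> matter.\<close>

record star_relations =
  nvars :: nat
  polys :: "star_poly list"
  bounds :: "nat \<Rightarrow> nat"

definition relation_set :: "star_relations \<Rightarrow> bool" where
  "relation_set R \<longleftrightarrow> 1 \<le> nvars R \<and>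
    (\<forall>p\<in>set (polys R). rational_poly p \<and> poly_vars p \<subseteq> {..<nvars R})"

text \<open>
  A *-polynomial with nonzero constant term can be evaluated only in a unital algebra, so a set of
  relations containing one is interpreted in unital algebras only. Relations without constant
  terms are interpreted in all C*-algebras.
\<close>

definition interpretable :: "('a, 'm) cstar_scheme \<Rightarrow> star_relations \<Rightarrow> bool" where
  "interpretable B R \<longleftrightarrow> (\<forall>p\<in>set (polys R). Poly_Mapping.lookup p [] = 0) \<or> Group.monoid B"

definition defect :: "('a, 'm) cstar_scheme \<Rightarrow> star_relations \<Rightarrow> (nat \<Rightarrow> 'a) \<Rightarrow> real" where
  "defect B R w = Max ((\<lambda>p. cnorm B (poly_val B w p)) ` set (polys R) \<union>
    (\<lambda>j. cnorm B (w j) - real (bounds R j)) ` {..<nvars R})"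

definition satisfies :: "('a, 'm) cstar_scheme \<Rightarrow> star_relations \<Rightarrow> (nat \<Rightarrow> 'a) \<Rightarrow> bool" where
  "satisfies B R w \<longleftrightarrow> (\<forall>p\<in>set (polys R). poly_val B w p = \<zero>\<^bsub>B\<^esub>) \<and>
    (\<forall>j<nvars R. cnorm B (w j) \<le> real (bounds R j))"

definition solutions :: "('a, 'm) cstar_scheme \<Rightarrow> star_relations \<Rightarrow> (nat \<Rightarrow> 'a) set" where
  "solutions B R = {w \<in> {..<nvars R} \<rightarrow>\<^sub>E carrier B. satisfies B R w}"

text \<open>
  Quantification over all C*-algebras is expressed by quantification over all C*-algebras whose
  carrier is a set of elements of the type \<^typ>\<open>nat \<Rightarrow> nat\<close>, which has the cardinality of the
  continuum. Nothing is lost: given a tuple \<open>w\<close> in an arbitrary C*-algebra, the C*-subalgebra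
  generated by \<open>w\<close> (and by the unit, if there is one) is separable, hence has at most continuum
  many elements and is isomorphic to a C*-algebra of this kind; the defect of \<open>w\<close> is the same in
  the subalgebra, and a tuple \<open>z\<close> satisfying the relations in the subalgebra satisfies them in
  the whole algebra.
\<close>

definition weak_stability_modulus :: "star_relations \<Rightarrow> (nat \<Rightarrow> nat) \<Rightarrow> bool" where
  "weak_stability_modulus R g \<longleftrightarrow>
    (\<forall>k. \<forall>B :: (nat \<Rightarrow> nat) cstar. cstar_algebra B \<and> interpretable B R \<longrightarrow>
      (\<forall>w \<in> {..<nvars R} \<rightarrow>\<^sub>E carrier B. defect B R w < 1 / 2 ^ g k \<longrightarrow>
        (\<exists>z \<in> {..<nvars R} \<rightarrow>\<^sub>E carrier B.
          Max ((\<lambda>j. cnorm B (w j \<ominus>\<^bsub>B\<^esub> z j)) ` {..<nvars R}) < 1 / 2 ^ k \<and>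
          satisfies B R z)))"

definition computably_weakly_stable :: "star_relations \<Rightarrow> bool" where
  "computably_weakly_stable R \<longleftrightarrow> (\<exists>g. computable g \<and> weak_stability_modulus R g)"

end

theory Submission
  imports Defs
begin

text \<open>
  The ball with centre \<open>c\<close> and radius \<open>r\<close> meets \<open>E\<close> iff there are \<open>k\<close> and a tuple \<open>w\<close> of rational
  points whose defect is less than \<open>2\<^sup>-\<^sup>g\<^sup>(\<^sup>k\<^sup>)\<close> and with \<open>\<parallel>c - w\<parallel> < r - 2\<^sup>-\<^sup>k\<close>: weak stability
  moves such a \<open>w\<close> by less than \<open>2\<^sup>-\<^sup>k\<close> into \<open>E\<close>, and conversely a point of \<open>E\<close> in the ball is
  approximated by tuples of rational points, whose defects tend to 0 by continuity. These strict
  inequalities between norms of rational points are semidecidable from upper approximations of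
  the norm, once the evaluation of *-polynomials has been made effective on codes.

  The unit need not be a rational point. It is nevertheless computable: if \<open>u\<close> is a rational
  point with \<open>\<parallel>u - 1\<parallel> \<le> 1/2\<close>, then the rational points \<open>1 - (1 - u)\<^sup>M\<close> converge to it effectively.
  So constant terms of the relations may be replaced by rational points with a known error.

  The modulus only speaks about algebras carried by \<^typ>\<open>nat \<Rightarrow> nat\<close>. As \<open>A\<close> is separable, its
  carrier injects into this type, and its structure is transported along the injection.
\<close>

section \<open>Closure properties of the computable functions\<close>

text \<open>A c.e. presentation approximates norms from above only: that a norm is small can be
  confirmed, that it is large cannot. This forces the form of the test, a finite list of strict
  upper bounds that is sound at every stage of the approximation. Such a test can never confirm an
  exact solution; weak stability is what turns the approximate solutions it does confirm into exact
  ones.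

  The centre of a rational ball of the power is a *-polynomial in tuples, and a relation evaluated
  at rational points is a *-polynomial in *-polynomials. Both must become rational points of the
  algebra itself before their norms can be tested, so the calculus of codes aims at substitution.
  The data that depend on the algebra and the relations alone, namely the seed \<open>u\<close>, the
  codes of the relations and the bounds for their constant terms, are finite in number and may be
  chosen without any algorithm.\<close>

definition list_computable :: "nat \<Rightarrow> (nat list \<Rightarrow> nat) \<Rightarrow> bool" where
  "list_computable n h \<longleftrightarrow> (\<exists>f. recursive n f \<and> (\<forall>xs. length xs = n \<longrightarrow> h xs = f xs))"

lemma all_length_1: "(\<forall>xs. length xs = Suc 0 \<longrightarrow> P xs) \<longleftrightarrow> (\<forall>x. P [x])"
  by (auto simp: length_Suc_conv)

lemma all_length_2: "(\<forall>xs. length xs = 2 \<longrightarrow> P xs) \<longleftrightarrow> (\<forall>x y. P [x, y])"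
  by (auto simp: numeral_2_eq_2 length_Suc_conv)

text \<open>Agreement with a recursive function is asked only on lists of the stated length, so
  \<open>hd xs\<close> and \<open>xs ! 0\<close> may replace each other and every argument can be
  written as a projection.\<close>

lemma computable_list: "computable F \<longleftrightarrow> list_computable 1 (\<lambda>xs. F (xs ! 0))"
  by (simp add: computable_def list_computable_def all_length_1)

lemma computable2_list: "computable2 F \<longleftrightarrow> list_computable 2 (\<lambda>xs. F (xs ! 0) (xs ! 1))"
  by (simp add: computable2_def list_computable_def all_length_2)

lemma list_computable_0: "list_computable n (\<lambda>xs. 0)"
  unfolding list_computable_def using recursive.zero by blast

lemma list_computable_proj: "i < n \<Longrightarrow> list_computable n (\<lambda>xs. xs ! i)"
  unfolding list_computable_def using recursive.proj by blast

lemma list_computable_comp1: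
  assumes "computable F" "list_computable n g" shows "list_computable n (\<lambda>xs. F (g xs))"
proof -
  obtain f where f: "recursive 1 f" "\<And>x. F x = f [x]"
    using assms(1) unfolding computable_def by blast
  obtain g' where g: "recursive n g'" "\<And>xs. length xs = n \<Longrightarrow> g xs = g' xs"
    using assms(2) unfolding list_computable_def by blast
  have "recursive n (\<lambda>xs. f (map (\<lambda>g. g xs) [g']))"
    by (rule recursive.comp[OF f(1)]) (use g in auto)
  then show ?thesis
    unfolding list_computable_def using f g by (intro exI[of _ "\<lambda>xs. f (map (\<lambda>g. g xs) [g'])"]) auto
qed

lemma list_computable_comp2:
  assumes "computable2 F" "list_computable n g" "list_computable n h" shows "list_computable n (\<lambda>xs. F (g xs) (h xs))"
proof -
  obtain f where f: "recursive 2 f" "\<And>x y. F x y = f [x, y]"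
    using assms(1) unfolding computable2_def by blast
  obtain g' where g: "recursive n g'" "\<And>xs. length xs = n \<Longrightarrow> g xs = g' xs"
    using assms(2) unfolding list_computable_def by blast
  obtain h' where h: "recursive n h'" "\<And>xs. length xs = n \<Longrightarrow> h xs = h' xs"
    using assms(3) unfolding list_computable_def by blast
  have "recursive n (\<lambda>xs. f (map (\<lambda>g. g xs) [g', h']))"
    by (rule recursive.comp[OF f(1)]) (use g h in auto)
  then show ?thesis
    unfolding list_computable_def using f g h by (intro exI[of _ "\<lambda>xs. f (map (\<lambda>g. g xs) [g', h'])"]) auto
qed

text \<open>The order \<open>b x\<close> follows \<open>recursive.prim\<close>, which recurses on
  the head of the list. One parameter \<open>x\<close> is enough, as several can be paired into one
  number.\<close>

lemma list_computable_prim: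
  assumes "computable G" "list_computable 3 (\<lambda>xs. H (xs ! 0) (xs ! 1) (xs ! 2))"
  shows "computable2 (\<lambda>b x. rec_nat (G x) (\<lambda>k r. H k r x) b)"
proof -
  obtain f where f: "recursive 1 f" "\<And>x. G x = f [x]"
    using assms(1) unfolding computable_def by blast
  obtain h where h: "recursive 3 h" "\<And>xs. length xs = 3 \<Longrightarrow> H (xs ! 0) (xs ! 1) (xs ! 2) = h xs"
    using assms(2) unfolding list_computable_def by blast
  have h': "H k r x = h [k, r, x]" for k r x
    using h(2)[of "[k, r, x]"] by simp
  have "recursive (Suc 1) (\<lambda>xs. rec_nat (f (tl xs)) (\<lambda>k r. h (k # r # tl xs)) (hd xs))"
    by (rule recursive.prim[OF f(1)]) (use h in \<open>simp add: numeral_3_eq_3\<close>)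
  then have "recursive 2 (\<lambda>xs. rec_nat (f (tl xs)) (\<lambda>k r. h (k # r # tl xs)) (hd xs))"
    by (simp add: numeral_2_eq_2)
  then show ?thesis
    unfolding computable2_def
    by (intro exI[of _ "\<lambda>xs. rec_nat (f (tl xs)) (\<lambda>k r. h (k # r # tl xs)) (hd xs)"])
       (simp add: f h')
qed

text \<open>The second assumption is the regularity that \<open>recursive.mu\<close> demands.
  Minimisation is applied only once, to invert the pairing function; the other closure properties
  come from composition and primitive recursion.\<close>

lemma computable_mu:
  assumes "computable2 F" "\<And>x. \<exists>k. F k x = 0"
  shows "computable (\<lambda>x. LEAST k. F k x = 0)"
proof -
  obtain f where f: "recursive 2 f" "\<And>x y. F x y = f [x, y]"
    using assms(1) unfolding computable2_def by blast
  have "recursive 1 (\<lambda>xs. LEAST k. f (k # xs) = 0)"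
  proof (rule recursive.mu)
    show "recursive (Suc 1) f"
      using f(1) by (simp add: numeral_2_eq_2)
    show "\<forall>xs. length xs = 1 \<longrightarrow> (\<exists>k. f (k # xs) = 0)"
      using assms(2) unfolding f(2) by (simp add: all_length_1)
  qed
  then show ?thesis
    unfolding computable_def
    by (intro exI[of _ "\<lambda>xs. LEAST k. f (k # xs) = 0"]) (simp add: f)
qed

lemma computable_Suc: "computable Suc"
  unfolding computable_def using recursive.succ by (intro exI[of _ "\<lambda>xs. Suc (hd xs)"]) simp

lemma computable_id: "computable (\<lambda>x. x)"
  unfolding computable_list by (rule list_computable_proj) simp

lemma computable_0: "computable (\<lambda>x. 0)"
  unfolding computable_list by (rule list_computable_0)

lemma computable_comp: "computable F \<Longrightarrow> computable G \<Longrightarrow> computable (\<lambda>x. F (G x))"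
  unfolding computable_list[of G] computable_list[of "\<lambda>x. F (G x)"] by (rule list_computable_comp1)

lemma computable_comp2:
  "computable2 F \<Longrightarrow> computable G \<Longrightarrow> computable H \<Longrightarrow> computable (\<lambda>x. F (G x) (H x))"
  unfolding computable_list[of G] computable_list[of H] computable_list[of "\<lambda>x. F (G x) (H x)"]
  by (rule list_computable_comp2)

lemma computable2_swap: "computable2 F \<Longrightarrow> computable2 (\<lambda>x y. F y x)"
  unfolding computable2_list[of "\<lambda>x y. F y x"] by (erule list_computable_comp2; rule list_computable_proj) auto

lemma computable2_add: "computable2 (+)"
proof -
  have "computable2 (\<lambda>b x. rec_nat x (\<lambda>k r. Suc r) b)"
    by (intro list_computable_prim computable_id list_computable_comp1[OF computable_Suc] list_computable_proj) simp
  moreover have "rec_nat x (\<lambda>k r. Suc r) b = b + x" for b x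
    by (induction b) auto
  ultimately show ?thesis by simp
qed

lemma computable_pred: "computable (\<lambda>x. x - 1)"
proof -
  \<comment> \<open>The step discards the accumulator and returns the counter, which trails the
    argument by one; \<open>x\<close> is a dummy parameter.\<close>
  have "computable2 (\<lambda>b x. rec_nat 0 (\<lambda>k r. k) b)"
    by (intro list_computable_prim computable_0 list_computable_proj) simp
  moreover have "rec_nat 0 (\<lambda>k r. k) b = b - 1" for b
    by (induction b) auto
  ultimately have "computable2 (\<lambda>b x. b - 1)" by simp
  from computable_comp2[OF this computable_id computable_id] show ?thesis .
qed

lemma computable2_diff: "computable2 (-)"
proof -
  have "computable2 (\<lambda>b x. rec_nat x (\<lambda>k r. r - 1) b)"
    by (intro list_computable_prim computable_id list_computable_comp1[OF computable_pred] list_computable_proj) simp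
  moreover have "rec_nat x (\<lambda>k r. r - 1) b = x - b" for b x
    by (induction b) auto
  ultimately have "computable2 (\<lambda>b x. x - b)" by simp
  then show ?thesis by (rule computable2_swap)
qed

lemma computable2_mult: "computable2 (*)"
proof -
  have "computable2 (\<lambda>b x. rec_nat 0 (\<lambda>k r. r + x) b)"
    by (intro list_computable_prim computable_0
        list_computable_comp2[OF computable2_add] list_computable_proj) simp_all
  moreover have "rec_nat 0 (\<lambda>k r. r + x) b = b * x" for b x
    by (induction b) auto
  ultimately show ?thesis by simp
qed

section \<open>The Cantor pairing function and its inverse\<close>

lemma computable_triangle: "computable triangle"
proof -
  have "computable2 (\<lambda>b x. rec_nat 0 (\<lambda>k r. r + Suc k) b)"
    by (intro list_computable_prim computable_0
        list_computable_comp2[OF computable2_add]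
        list_computable_comp1[OF computable_Suc] list_computable_proj)
       simp_all
  moreover have "rec_nat 0 (\<lambda>k r. r + Suc k) b = triangle b" for b
    by (induction b) auto
  ultimately have "computable2 (\<lambda>b x. triangle b)" by simp
  from computable_comp2[OF this computable_id computable_id] show ?thesis .
qed

lemma computable2_prod_encode: "computable2 (\<lambda>x y. prod_encode (x, y))"
  unfolding prod_encode_def prod.case computable2_list
  by (intro list_computable_comp2[OF computable2_add] list_computable_comp1[OF computable_triangle] list_computable_proj) simp_all

lemma triangle_mono: "m \<le> n \<Longrightarrow> triangle m \<le> triangle n"
  unfolding triangle_def by (intro div_le_mono mult_le_mono) auto

text \<open>The codes on the diagonal \<open>a + b = d\<close> fill the interval from
  \<open>triangle d\<close> up to, but excluding, \<open>triangle (Suc d)\<close>. The truncated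
  difference vanishes exactly when the code is below \<open>triangle (Suc k)\<close>, so the least
  such \<open>k\<close> is the diagonal.\<close>

lemma diagonal_of_code:
  "(LEAST k. Suc (prod_encode (a, b)) - triangle (Suc k) = 0) = a + b"
proof (rule Least_equality)
  show "Suc (prod_encode (a, b)) - triangle (Suc (a + b)) = 0"
    by (simp add: prod_encode_def)
next
  fix k assume "Suc (prod_encode (a, b)) - triangle (Suc k) = 0"
  then have "triangle (a + b) + a < triangle (Suc k)"
    by (simp add: prod_encode_def)
  then have "\<not> Suc k \<le> a + b"
    using triangle_mono[of "Suc k" "a + b"] by linarith
  then show "a + b \<le> k" by simp
qed

lemma computable_prod_decode:
  "computable (\<lambda>n. fst (prod_decode n))" "computable (\<lambda>n. snd (prod_decode n))"
proof -
  define s where "s n = (LEAST k. Suc n - triangle (Suc k) = 0)" for n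
  have s: "computable s"
    unfolding s_def
  proof (rule computable_mu)
    show "computable2 (\<lambda>k x. Suc x - triangle (Suc k))"
      unfolding computable2_list
      by (intro list_computable_comp2[OF computable2_diff] list_computable_comp1[OF computable_Suc]
          list_computable_comp1[OF computable_triangle] list_computable_proj) simp_all
    show "\<exists>k. Suc x - triangle (Suc k) = 0" for x
      by (intro exI[of _ x]) simp
  qed
  \<comment> \<open>Once the diagonal is known,
    \<open>prod_encode (a, b) = triangle (a + b) + a\<close> yields \<open>a\<close>, and
    \<open>b\<close> is what remains of the diagonal.\<close>
  have fst: "fst (prod_decode n) = n - triangle (s n)"
    and snd: "snd (prod_decode n) = s n - (n - triangle (s n))" for n
  proof -
    obtain a b where n: "n = prod_encode (a, b)"
      by (metis prod_decode_inverse surj_pair)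
    have "s n = a + b"
      unfolding n s_def by (rule diagonal_of_code)
    then show "fst (prod_decode n) = n - triangle (s n)"
      "snd (prod_decode n) = s n - (n - triangle (s n))"
      by (simp_all add: n) (simp_all add: prod_encode_def)
  qed
  show "computable (\<lambda>n. fst (prod_decode n))" "computable (\<lambda>n. snd (prod_decode n))"
    unfolding fst snd
    by (intro computable_comp2[OF computable2_diff] computable_comp[OF computable_triangle]
        s computable_id)+
qed

section \<open>Computability over types coded bijectively by the natural numbers\<close>

class coded =
  fixes enc :: "'a \<Rightarrow> nat" and dec :: "nat \<Rightarrow> 'a"
  assumes dec_enc [simp]: "dec (enc x) = x" and enc_dec [simp]: "enc (dec n) = n"

instantiation nat :: coded
begin
definition "enc_nat (n :: nat) = n"
definition "dec_nat (n :: nat) = n"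
instance by standard (auto simp: enc_nat_def dec_nat_def)
end

instantiation int :: coded
begin
definition "enc_int = int_encode"
definition "dec_int = int_decode"
instance by standard (auto simp: enc_int_def dec_int_def)
end

instantiation prod :: (coded, coded) coded
begin
definition "enc_prod p = prod_encode (enc (fst p), enc (snd p))"
definition "dec_prod n = (dec (fst (prod_decode n)), dec (snd (prod_decode n)))"
instance by standard (auto simp: enc_prod_def dec_prod_def)
end

instantiation list :: (coded) coded
begin
definition "enc_list xs = list_encode (map enc xs)"
definition "dec_list n = map dec (list_decode n)"
instance by standard (auto simp: enc_list_def dec_list_def comp_def)
end

text \<open>As \<open>enc\<close> and \<open>dec\<close> are mutually inverse, every number is a
  code: decoding needs no validity check, the inner code of a composition cancels, and a search over
  all numbers is a search over the whole type.\<close>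

definition cmp :: "('a :: coded \<Rightarrow> 'b :: coded) \<Rightarrow> bool" where
  "cmp f \<longleftrightarrow> computable (\<lambda>n. enc (f (dec n)))"

definition cmpp :: "('a :: coded \<Rightarrow> bool) \<Rightarrow> bool" where
  "cmpp P \<longleftrightarrow> cmp (\<lambda>x. of_bool (P x) :: nat)"

named_theorems cmp_intros

lemma cmp_comp: "cmp f \<Longrightarrow> cmp g \<Longrightarrow> cmp (\<lambda>x. f (g x))"
  unfolding cmp_def by (drule (1) computable_comp) simp

lemma cmp_id [cmp_intros]: "cmp (\<lambda>x. x)"
  by (simp add: cmp_def computable_id)

text \<open>The constant may be known only through its existence; this covers the codes that are
  later picked by \<open>SOME\<close>.\<close>

lemma cmp_const [cmp_intros]: "cmp (\<lambda>x. c)"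
proof -
  have "computable (\<lambda>x. n)" for n :: nat
    by (induction n) (auto intro: computable_0 computable_comp[OF computable_Suc])
  then show ?thesis by (simp add: cmp_def)
qed

lemma cmp_Pair [cmp_intros]: "cmp f \<Longrightarrow> cmp g \<Longrightarrow> cmp (\<lambda>x. (f x, g x))"
  unfolding cmp_def enc_prod_def fst_conv snd_conv by (rule computable_comp2[OF computable2_prod_encode])

lemma cmp_fst [cmp_intros]: "cmp f \<Longrightarrow> cmp (\<lambda>x. fst (f x))"
  by (erule cmp_comp[rotated]) (simp add: cmp_def dec_prod_def computable_prod_decode)

lemma cmp_snd [cmp_intros]: "cmp f \<Longrightarrow> cmp (\<lambda>x. snd (f x))"
  by (erule cmp_comp[rotated]) (simp add: cmp_def dec_prod_def computable_prod_decode)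

lemma cmp_comp2:
  assumes "cmp (\<lambda>p. f (fst p) (snd p))" "cmp g" "cmp h"
  shows "cmp (\<lambda>x. f (g x) (h x))"
  using cmp_comp[OF assms(1) cmp_Pair[OF assms(2,3)]] by simp

lemma cmp_comp3:
  assumes "cmp (\<lambda>p. f (fst p) (fst (snd p)) (snd (snd p)))" "cmp g" "cmp h" "cmp k"
  shows "cmp (\<lambda>x. f (g x) (h x) (k x))"
  using cmp_comp[OF assms(1) cmp_Pair[OF assms(2) cmp_Pair[OF assms(3,4)]]] by simp

lemma cmp_enc [cmp_intros]: "cmp f \<Longrightarrow> cmp (\<lambda>x. enc (f x))"
  by (simp add: cmp_def enc_nat_def)

lemma cmp_dec [cmp_intros]: "cmp f \<Longrightarrow> cmp (\<lambda>x. dec (f x))"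
  by (simp add: cmp_def enc_nat_def)

lemma cmp_computable2: "computable2 F \<Longrightarrow> cmp f \<Longrightarrow> cmp g \<Longrightarrow> cmp (\<lambda>x. F (f x) (g x))"
  unfolding cmp_def enc_nat_def by (rule computable_comp2)

lemma cmp_computable: "computable F \<Longrightarrow> cmp f \<Longrightarrow> cmp (\<lambda>x. F (f x))"
  unfolding cmp_def enc_nat_def by (rule computable_comp)

lemmas cmp_add [cmp_intros] = cmp_computable2[OF computable2_add]
lemmas cmp_diff [cmp_intros] = cmp_computable2[OF computable2_diff]
lemmas cmp_mult [cmp_intros] = cmp_computable2[OF computable2_mult]
lemmas cmp_Suc [cmp_intros] = cmp_computable[OF computable_Suc]

text \<open>Parameter, counter and accumulator are packed into one number, so a unary computable
  step suffices, and parameter and accumulator may have any coded type.\<close>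

lemma cmp_rec_nat [cmp_intros]:
  fixes g :: "'a :: coded \<Rightarrow> 'b :: coded"
  assumes "cmp g" "cmp (\<lambda>p. h (fst p) (fst (snd p)) (snd (snd p)))" "cmp b"
  shows "cmp (\<lambda>x. rec_nat (g x) (h x) (b x))"
proof -
  define G where "G n = enc (g (dec n))" for n
  define H where "H q = (case dec q :: 'a \<times> nat \<times> 'b of (x, k, r) \<Rightarrow> enc (h x k r))" for q
  have G: "computable G" and H: "computable H"
    using assms(1,2) unfolding cmp_def G_def[abs_def] H_def[abs_def] case_prod_beta by blast+
  have "list_computable 3 (\<lambda>xs. H (prod_encode (xs ! 2, prod_encode (xs ! 0, xs ! 1))))"
    by (rule list_computable_comp1[OF H] list_computable_comp2[OF computable2_prod_encode] list_computable_proj | simp)+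
  with G have "computable2 (\<lambda>m n. rec_nat (G n) (\<lambda>k r. H (prod_encode (n, prod_encode (k, r)))) m)"
    by (rule list_computable_prim)
  from computable_comp2[OF this assms(3)[unfolded cmp_def enc_nat_def] computable_id]
  have "computable (\<lambda>n. rec_nat (G n) (\<lambda>k r. H (prod_encode (n, prod_encode (k, r)))) (b (dec n)))" .
  moreover have "rec_nat (G n) (\<lambda>k r. H (prod_encode (n, prod_encode (k, r)))) m =
      enc (rec_nat (g (dec n)) (h (dec n)) m)" for m n
    by (induction m) (simp_all add: G_def H_def dec_prod_def dec_nat_def)
  ultimately show ?thesis by (simp add: cmp_def)
qed

lemma cmpp_le [cmp_intros]: "cmp f \<Longrightarrow> cmp g \<Longrightarrow> cmpp (\<lambda>x. f x \<le> (g x :: nat))"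
proof -
  assume "cmp f" "cmp g"
  \<comment> \<open>The truncated difference is 0 exactly if the inequality holds; subtracting it
    from 1 gives the characteristic function.\<close>
  then have "cmp (\<lambda>x. 1 - (f x - g x))" by (intro cmp_intros)
  moreover have "1 - (f x - g x) = of_bool (f x \<le> g x)" for x by auto
  ultimately show ?thesis by (simp add: cmpp_def)
qed

lemma cmpp_conj [cmp_intros]: "cmpp P \<Longrightarrow> cmpp Q \<Longrightarrow> cmpp (\<lambda>x. P x \<and> Q x)"
  unfolding cmpp_def of_bool_conj by (intro cmp_intros)

lemma cmpp_True: "cmpp (\<lambda>x. True)"
  unfolding cmpp_def by (rule cmp_const)

lemma cmpp_less [cmp_intros]: "cmp f \<Longrightarrow> cmp g \<Longrightarrow> cmpp (\<lambda>x. f x < (g x :: nat))"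
  unfolding Suc_le_eq[symmetric] by (intro cmp_intros)

lemma cmpp_eq_nat [cmp_intros]: "cmp f \<Longrightarrow> cmp g \<Longrightarrow> cmpp (\<lambda>x. f x = (g x :: nat))"
  unfolding eq_iff by (intro cmp_intros)

text \<open>The index set is fixed and finite, so computability of each \<open>P j\<close>
  separately is enough; no uniformity in \<open>j\<close> is asked. The index may thus be a relation
  of \<open>R\<close>, which has no code type.\<close>

lemma cmpp_ball:
  assumes "finite J" "\<And>j. j \<in> J \<Longrightarrow> cmpp (P j)"
  shows "cmpp (\<lambda>x. \<forall>j\<in>J. P j x)"
  using assms by (induction J) (auto intro: cmpp_True cmpp_conj)

lemma cmp_if [cmp_intros]:
  assumes "cmpp P" "cmp f" "cmp g"
  shows "cmp (\<lambda>x. if P x then f x else g x)"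
proof -
  \<comment> \<open>The truth value serves as the number of iterations: none leaves
    \<open>g x\<close>, one overwrites it with \<open>f x\<close>.\<close>
  have "cmp (\<lambda>x. rec_nat (g x) (\<lambda>k r. f x) (of_bool (P x)))"
    using assms(1,3) cmp_comp[OF assms(2) cmp_fst[OF cmp_id]] unfolding cmpp_def
    by (intro cmp_intros)
  moreover have "rec_nat (g x) (\<lambda>k r. f x) (of_bool (P x)) = (if P x then f x else g x)" for x
    by simp
  ultimately show ?thesis by simp
qed

lemma cmp_power [cmp_intros]: "cmp f \<Longrightarrow> cmp g \<Longrightarrow> cmp (\<lambda>x. f x ^ g x :: nat)"
proof -
  assume fg: "cmp f" "cmp g"
  then have "cmp (\<lambda>x. rec_nat 1 (\<lambda>k r. f x * r) (g x))"
    using cmp_comp[OF fg(1) cmp_fst[OF cmp_id]] by (intro cmp_intros)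
  moreover have "rec_nat 1 (\<lambda>k r. f x * r) m = f x ^ m" for x m
    by (induction m) auto
  ultimately show ?thesis by simp
qed

lemma cmpp_even [cmp_intros]: "cmp f \<Longrightarrow> cmpp (\<lambda>x. even (f x :: nat))"
proof -
  assume "cmp f"
  then have "cmp (\<lambda>x. rec_nat (1 :: nat) (\<lambda>k r. 1 - r) (f x))" by (intro cmp_intros)
  moreover have "rec_nat (1 :: nat) (\<lambda>k r. 1 - r) n = of_bool (even n)" for n :: nat
    by (induction n) auto
  ultimately show ?thesis by (simp add: cmpp_def)
qed

lemma cmp_div2 [cmp_intros]: "cmp f \<Longrightarrow> cmp (\<lambda>x. f x div (2 :: nat))"
proof -
  assume "cmp f"
  then have "cmp (\<lambda>x. rec_nat (0 :: nat) (\<lambda>k r. if even k then r else Suc r) (f x))"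
    by (intro cmp_intros)
  moreover have "rec_nat (0 :: nat) (\<lambda>k r. if even k then r else Suc r) n = n div 2" for n :: nat
    by (induction n) (auto elim: evenE oddE)
  ultimately show ?thesis by simp
qed

section \<open>Lists\<close>

lemma enc_Nil [simp]: "enc [] = 0"
  by (simp add: enc_list_def)

lemma enc_Cons: "enc (x # xs) = Suc (enc (x, xs))"
  by (simp add: enc_list_def enc_prod_def)

text \<open>Supplies the number of iterations for a fold: the code of a list is at hand as a number,
  and that many steps consume the whole list.\<close>

lemma length_le_enc: "length xs \<le> enc xs"
proof (induction xs)
  case (Cons x xs)
  have "enc xs \<le> enc (x, xs)"
    unfolding enc_prod_def fst_conv snd_conv by (rule le_prod_encode_2)
  with Cons show ?case unfolding enc_Cons by simp
qed simp

lemma cmp_Cons [cmp_intros]: "cmp f \<Longrightarrow> cmp g \<Longrightarrow> cmp (\<lambda>x. f x # g x)"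
proof -
  assume "cmp f" "cmp g"
  then have "cmp (\<lambda>x. Suc (enc (f x, g x)))" by (intro cmp_intros)
  then show ?thesis unfolding enc_Cons[symmetric] by (simp add: cmp_def enc_nat_def)
qed

text \<open>Code 0 is the empty list, and \<open>Suc n\<close> is the list whose head and tail are
  paired in \<open>n\<close>; the case distinction is a zero test followed by a predecessor.\<close>

lemma cmp_case_list [cmp_intros]:
  assumes "cmp xs" "cmp n" "cmp (\<lambda>p. c (fst p) (fst (snd p)) (snd (snd p)))"
  shows "cmp (\<lambda>x. case xs x of [] \<Rightarrow> n x | y # ys \<Rightarrow> c x y ys)"
proof -
  have "cmp (\<lambda>x. if enc (xs x) = 0 then n x
      else (\<lambda>p. c (fst p) (fst (snd p)) (snd (snd p))) (x, dec (enc (xs x) - 1)))"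
    by (rule cmp_if[OF _ assms(2) cmp_comp[OF assms(3)]]) (intro cmp_intros assms(1))+
  moreover have "(if enc (xs x) = 0 then n x
      else (\<lambda>p. c (fst p) (fst (snd p)) (snd (snd p))) (x, dec (enc (xs x) - 1))) =
      (case xs x of [] \<Rightarrow> n x | y # ys \<Rightarrow> c x y ys)" for x
    by (cases "xs x") (simp_all add: enc_Cons)
  ultimately show ?thesis by simp
qed

text \<open>The state of a fold is the part of the list still to be read together with the
  accumulator. On an exhausted list the step is the identity, so surplus iterations do no
  harm.\<close>

definition fold_step :: "('a \<Rightarrow> 'b \<Rightarrow> 'b) \<Rightarrow> 'a list \<times> 'b \<Rightarrow> 'a list \<times> 'b" where
  "fold_step f p = (case fst p of [] \<Rightarrow> p | y # ys \<Rightarrow> (ys, f y (snd p)))"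

lemma fold_step_simps [simp]:
  "fold_step f ([], a) = ([], a)" "fold_step f (y # ys, a) = (ys, f y a)"
  by (simp_all add: fold_step_def)

lemma fold_step_iterate:
  "length xs \<le> n \<Longrightarrow> rec_nat (xs, a) (\<lambda>_. fold_step f) n = ([], fold f xs a)"
proof -
  \<comment> \<open>\<open>rec_nat\<close> adds the newest step on the outside, whereas the list is
    consumed from the first step on; this moves one step to the inside.\<close>
  have step: "rec_nat (xs, a) (\<lambda>_. fold_step f) (Suc n) =
      rec_nat (fold_step f (xs, a)) (\<lambda>_. fold_step f) n" for xs a n
    by (induction n) simp_all
  show "length xs \<le> n \<Longrightarrow> ?thesis"
  proof (induction n arbitrary: xs a)
    case (Suc n)
    then show ?case
      unfolding step by (cases xs) auto
  qed simp
qed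

lemma cmp_fold [cmp_intros]:
  assumes "cmp (\<lambda>p. f (fst p) (fst (snd p)) (snd (snd p)))" "cmp xs" "cmp a"
  shows "cmp (\<lambda>x. fold (f x) (xs x) (a x))"
proof -
  have "cmp (\<lambda>x. snd (rec_nat (xs x, a x) (\<lambda>_. fold_step (f x)) (enc (xs x))))"
    unfolding fold_step_def
    by (intro cmp_intros assms(2,3) cmp_comp3[where f = f, OF assms(1)])
  then show ?thesis
    by (simp add: fold_step_iterate length_le_enc)
qed

lemma cmp_rev [cmp_intros]: "cmp f \<Longrightarrow> cmp (\<lambda>x. rev (f x))"
  unfolding rev_conv_fold by (intro cmp_intros)

lemma cmp_foldr [cmp_intros]:
  assumes "cmp (\<lambda>p. f (fst p) (fst (snd p)) (snd (snd p)))" "cmp xs" "cmp a"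
  shows "cmp (\<lambda>x. foldr (f x) (xs x) (a x))"
  unfolding foldr_conv_fold by (intro cmp_intros assms(2,3) cmp_comp3[where f = f, OF assms(1)])

lemma cmp_append [cmp_intros]: "cmp f \<Longrightarrow> cmp g \<Longrightarrow> cmp (\<lambda>x. f x @ g x)"
proof -
  assume "cmp f" "cmp g"
  then have "cmp (\<lambda>x. foldr (#) (f x) (g x))" by (intro cmp_intros)
  moreover have "foldr (#) xs ys = xs @ ys" for xs ys :: "'b list"
    by (induction xs) auto
  ultimately show ?thesis by simp
qed

lemma cmp_map [cmp_intros]:
  assumes "cmp (\<lambda>p. f (fst p) (snd p))" "cmp xs"
  shows "cmp (\<lambda>x. map (f x) (xs x))"
proof -
  have "cmp (\<lambda>x. foldr (\<lambda>y ys. f x y # ys) (xs x) [])"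
    by (intro cmp_intros assms(2) cmp_comp2[where f = f, OF assms(1)])
  moreover have "foldr (\<lambda>y ys. g y # ys) ys [] = map g ys" for g :: "'b \<Rightarrow> 'c" and ys
    by (induction ys) auto
  ultimately show ?thesis by simp
qed

lemma cmp_concat [cmp_intros]: "cmp f \<Longrightarrow> cmp (\<lambda>x. concat (f x))"
  unfolding concat_conv_foldr by (intro cmp_intros)

section \<open>Integers, rationals and Gaussian rationals\<close>

lemma enc_int_eq: "enc z = (if 0 \<le> z then 2 * nat z else Suc (2 * nat (- z - 1)))"
  by (simp add: enc_int_def int_encode_def sum_encode_def)

lemma cmp_nat_of_int [cmp_intros]: "cmp f \<Longrightarrow> cmp (\<lambda>x. nat (f x))"
proof -
  assume "cmp f"
  then have "cmp (\<lambda>x. if even (enc (f x)) then enc (f x) div 2 else 0)"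
    by (intro cmp_intros)
  moreover have "(if even (enc z) then enc z div 2 else 0) = nat z" for z :: int
    by (simp add: enc_int_eq)
  ultimately show ?thesis by simp
qed

text \<open>Integer operations are carried out on the natural numbers \<open>nat z\<close> and
  \<open>nat (- z)\<close>; this is the way back from a difference of naturals to an
  integer.\<close>

lemma cmp_int_diff_nat:
  assumes "cmp f" "cmp g" shows "cmp (\<lambda>x. int (f x) - int (g x))"
proof -
  \<comment> \<open>An integer \<open>n \<ge> 0\<close> has code \<open>2 * n\<close>, and
    \<open>- n\<close> with \<open>n > 0\<close> has code \<open>2 * n - 1\<close>.\<close>
  have "cmp (\<lambda>x. if g x \<le> f x then 2 * (f x - g x) else 2 * (g x - f x) - 1)"
    by (intro cmp_intros assms)
  moreover have "(if b \<le> a then 2 * (a - b) else 2 * (b - a) - 1) = enc (int a - int b)" for a b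
    unfolding enc_int_eq by (simp; arith)
  ultimately show ?thesis by (simp add: cmp_def enc_nat_def)
qed

lemma cmp_uminus_int [cmp_intros]: "cmp f \<Longrightarrow> cmp (\<lambda>x. - f x :: int)"
proof -
  assume f: "cmp f"
  \<comment> \<open>The negative part is read off the code: halving an odd code
    \<open>2 * n - 1\<close> gives \<open>n - 1\<close>.\<close>
  have "cmp (\<lambda>x. if even (enc (f x)) then 0 else Suc (enc (f x) div 2))"
    by (intro cmp_intros f)
  moreover have "(if even (enc z) then 0 else Suc (enc z div 2)) = nat (- z)" for z :: int
    by (auto simp: enc_int_eq)
  ultimately have "cmp (\<lambda>x. nat (- f x))" by simp
  from cmp_int_diff_nat[OF this cmp_nat_of_int[OF f]]
  have "cmp (\<lambda>x. int (nat (- f x)) - int (nat (f x)))" .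
  moreover have "int (nat (- z)) - int (nat z) = - z" for z
    by simp
  ultimately show ?thesis by (simp only:)
qed

lemma cmp_int [cmp_intros]: "cmp f \<Longrightarrow> cmp (\<lambda>x. int (f x))"
  using cmp_int_diff_nat[of f "\<lambda>x. 0"] by (simp add: cmp_const)

lemma cmp_add_int [cmp_intros]:
  assumes "cmp f" "cmp g" shows "cmp (\<lambda>x. f x + g x :: int)"
proof -
  have "cmp (\<lambda>x. int (nat (f x) + nat (g x)) - int (nat (- f x) + nat (- g x)))"
    by (intro cmp_int_diff_nat cmp_intros assms)
  moreover have "int (nat a + nat b) - int (nat (- a) + nat (- b)) = a + b" for a b
    by simp
  ultimately show ?thesis by simp
qed

lemma cmp_diff_int [cmp_intros]: "cmp f \<Longrightarrow> cmp g \<Longrightarrow> cmp (\<lambda>x. f x - g x :: int)"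
  unfolding diff_conv_add_uminus by (intro cmp_intros)

lemma cmp_mult_int [cmp_intros]:
  assumes "cmp f" "cmp g" shows "cmp (\<lambda>x. f x * g x :: int)"
proof -
  have "cmp (\<lambda>x. int (nat (f x) * nat (g x) + nat (- f x) * nat (- g x)) -
      int (nat (f x) * nat (- g x) + nat (- f x) * nat (g x)))"
    by (intro cmp_int_diff_nat cmp_intros assms)
  moreover have "int (nat a * nat b + nat (- a) * nat (- b)) -
      int (nat a * nat (- b) + nat (- a) * nat b) = a * b" for a b
    by (cases "a \<ge> 0"; cases "b \<ge> 0") (simp_all add: int_nat_eq)
  ultimately show ?thesis by simp
qed

lemma cmpp_less_int [cmp_intros]:
  assumes "cmp f" "cmp g" shows "cmpp (\<lambda>x. f x < (g x :: int))"
proof -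
  have "cmpp (\<lambda>x. 0 < nat (g x - f x))" by (intro cmp_intros assms)
  then show ?thesis by simp
qed

type_synonym rat_code = "int \<times> nat"
type_synonym gaussian_code = "rat_code \<times> rat_code"

text \<open>Fractions are left unreduced. Many codes share a value, but only strict inequalities
  between values are ever tested.\<close>

definition rat_val :: "rat_code \<Rightarrow> rat" where
  "rat_val p = of_int (fst p) / of_nat (Suc (snd p))"

definition rat_add :: "rat_code \<Rightarrow> rat_code \<Rightarrow> rat_code" where
  "rat_add p q = (fst p * int (Suc (snd q)) + fst q * int (Suc (snd p)),
     Suc (snd p) * Suc (snd q) - 1)"

definition rat_mult :: "rat_code \<Rightarrow> rat_code \<Rightarrow> rat_code" where
  "rat_mult p q = (fst p * fst q, Suc (snd p) * Suc (snd q) - 1)"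

definition rat_neg :: "rat_code \<Rightarrow> rat_code" where
  "rat_neg p = (- fst p, snd p)"

lemma rat_decode_eq: "rat_decode n = rat_val (dec n)"
  by (simp add: rat_decode_def rat_val_def dec_prod_def dec_int_def dec_nat_def case_prod_beta)

lemma rat_val_simps [simp]:
  "rat_val (rat_add p q) = rat_val p + rat_val q"
  "rat_val (rat_mult p q) = rat_val p * rat_val q"
  "rat_val (rat_neg p) = - rat_val p"
proof -
  have "rat_of_nat (Suc (Suc (snd p) * Suc (snd q) - 1)) = of_nat (Suc (snd p)) * of_nat (Suc (snd q))"
    by (simp only: of_nat_mult[symmetric]) simp
  note nz = this of_nat_neq_0[where 'a = rat]
  show "rat_val (rat_add p q) = rat_val p + rat_val q"
    unfolding rat_val_def rat_add_def fst_conv snd_conv nz(1)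
    by (simp add: add_frac_eq nz(2) del: of_nat_Suc)
  show "rat_val (rat_mult p q) = rat_val p * rat_val q"
    unfolding rat_val_def rat_mult_def fst_conv snd_conv nz(1) by simp
qed (simp add: rat_val_def rat_neg_def)

lemma rat_val_less_iff:
  "rat_val p < rat_val q \<longleftrightarrow> fst p * int (Suc (snd q)) < fst q * int (Suc (snd p))"
proof -
  have "rat_val p < rat_val q \<longleftrightarrow>
      rat_of_int (fst p * int (Suc (snd q))) < rat_of_int (fst q * int (Suc (snd p)))"
    by (simp add: rat_val_def divide_less_eq less_divide_eq field_simps del: of_nat_Suc)
  then show ?thesis by (simp only: of_int_less_iff)
qed

lemma cmp_rat_add [cmp_intros]: "cmp f \<Longrightarrow> cmp g \<Longrightarrow> cmp (\<lambda>x. rat_add (f x) (g x))"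
  unfolding rat_add_def by (intro cmp_intros)

lemma cmp_rat_mult [cmp_intros]: "cmp f \<Longrightarrow> cmp g \<Longrightarrow> cmp (\<lambda>x. rat_mult (f x) (g x))"
  unfolding rat_mult_def by (intro cmp_intros)

lemma cmp_rat_neg [cmp_intros]: "cmp f \<Longrightarrow> cmp (\<lambda>x. rat_neg (f x))"
  unfolding rat_neg_def by (intro cmp_intros)

lemma cmpp_rat_less [cmp_intros]: "cmp f \<Longrightarrow> cmp g \<Longrightarrow> cmpp (\<lambda>x. rat_val (f x) < rat_val (g x))"
  unfolding rat_val_less_iff by (intro cmp_intros)

definition gaussian_val :: "gaussian_code \<Rightarrow> complex" where
  "gaussian_val c = Complex (of_rat (rat_val (fst c))) (of_rat (rat_val (snd c)))"

definition gaussian_mult :: "gaussian_code \<Rightarrow> gaussian_code \<Rightarrow> gaussian_code" where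
  "gaussian_mult c d =
    (rat_add (rat_mult (fst c) (fst d)) (rat_neg (rat_mult (snd c) (snd d))),
     rat_add (rat_mult (fst c) (snd d)) (rat_mult (snd c) (fst d)))"

definition gaussian_cnj :: "gaussian_code \<Rightarrow> gaussian_code" where
  "gaussian_cnj c = (fst c, rat_neg (snd c))"

lemma gaussian_decode_eq: "gaussian_decode n = gaussian_val (dec n)"
  by (simp add: gaussian_decode_def gaussian_val_def dec_prod_def rat_decode_eq case_prod_beta)

lemma gaussian_val_simps [simp]:
  "gaussian_val (gaussian_mult c d) = gaussian_val c * gaussian_val d"
  "gaussian_val (gaussian_cnj c) = cnj (gaussian_val c)"
  by (simp_all add: gaussian_val_def gaussian_mult_def gaussian_cnj_def complex_eq_iff
      of_rat_add of_rat_mult of_rat_minus of_rat_diff)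

lemma cmp_gaussian_mult [cmp_intros]: "cmp f \<Longrightarrow> cmp g \<Longrightarrow> cmp (\<lambda>x. gaussian_mult (f x) (g x))"
  unfolding gaussian_mult_def by (intro cmp_intros)

lemma cmp_gaussian_cnj [cmp_intros]: "cmp f \<Longrightarrow> cmp (\<lambda>x. gaussian_cnj (f x))"
  unfolding gaussian_cnj_def by (intro cmp_intros)

section \<open>Codes of *-polynomials\<close>

text \<open>A word is a first letter with a list of further ones, so the empty word has no code and
  no constant term can arise. A word may occur several times in a \<open>poly_code\<close>; its
  coefficients then add up.\<close>

type_synonym word_code = "nat \<times> nat list"
type_synonym poly_code = "(gaussian_code \<times> word_code) list"

definition word_of :: "word_code \<Rightarrow> (nat \<times> bool) list" where
  "word_of u = map letter_decode (fst u # snd u)"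

definition poly_of :: "poly_code \<Rightarrow> star_poly" where
  "poly_of P = (\<Sum>m\<leftarrow>P. Poly_Mapping.single (word_of (snd m)) (gaussian_val (fst m)))"

lemma poly_decode_eq: "poly_decode n = poly_of (dec n)"
proof -
  have "map dec xs = xs" for xs :: "nat list"
    by (induction xs) (simp_all add: dec_nat_def)
  then have "monomial_decode = (\<lambda>m.
      Poly_Mapping.single (word_of (snd (dec m :: gaussian_code \<times> word_code)))
        (gaussian_val (fst (dec m :: gaussian_code \<times> word_code))))"
    by (simp add: fun_eq_iff monomial_decode_def word_decode_def word_of_def dec_prod_def gaussian_decode_eq
        dec_list_def dec_nat_def case_prod_beta)
  then show ?thesis
    by (simp add: poly_decode_def poly_of_def dec_list_def comp_def)
qed

definition word_append :: "word_code \<Rightarrow> word_code \<Rightarrow> word_code" where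
  "word_append u v = (fst u, snd u @ fst v # snd v)"

text \<open>Letters \<open>2 * j\<close> and \<open>2 * j + 1\<close> are a variable and its
  adjoint, so the adjoint flips the last bit.\<close>

definition letter_star :: "nat \<Rightarrow> nat" where
  "letter_star n = (if even n then Suc n else n - 1)"

text \<open>The branch for \<open>[]\<close> is never reached, since a word code has at least one
  letter.\<close>

definition word_star :: "word_code \<Rightarrow> word_code" where
  "word_star u = (case rev (map letter_star (fst u # snd u)) of [] \<Rightarrow> u | l # ls \<Rightarrow> (l, ls))"

definition code_smult :: "gaussian_code \<Rightarrow> poly_code \<Rightarrow> poly_code" where
  "code_smult c P = map (\<lambda>m. (gaussian_mult c (fst m), snd m)) P"

definition code_mult :: "poly_code \<Rightarrow> poly_code \<Rightarrow> poly_code" where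
  "code_mult P Q = concat (map (\<lambda>m.
     map (\<lambda>n. (gaussian_mult (fst m) (fst n), word_append (snd m) (snd n))) Q) P)"

definition code_star :: "poly_code \<Rightarrow> poly_code" where
  "code_star P = map (\<lambda>m. (gaussian_cnj (fst m), word_star (snd m))) P"

definition letter_subst :: "(nat \<Rightarrow> poly_code) \<Rightarrow> nat \<Rightarrow> poly_code" where
  "letter_subst \<sigma> n = (if even n then \<sigma> (n div 2) else code_star (\<sigma> (n div 2)))"

text \<open>The fold starts from the first letter rather than from an empty product, for which there
  is no code.\<close>

definition word_subst :: "(nat \<Rightarrow> poly_code) \<Rightarrow> word_code \<Rightarrow> poly_code" where
  "word_subst \<sigma> u = fold (\<lambda>l P. code_mult P (letter_subst \<sigma> l)) (snd u) (letter_subst \<sigma> (fst u))"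

definition code_subst :: "(nat \<Rightarrow> poly_code) \<Rightarrow> poly_code \<Rightarrow> poly_code" where
  "code_subst \<sigma> P = concat (map (\<lambda>m. code_smult (fst m) (word_subst \<sigma> (snd m))) P)"

lemma cmp_word_append [cmp_intros]: "cmp f \<Longrightarrow> cmp g \<Longrightarrow> cmp (\<lambda>x. word_append (f x) (g x))"
  unfolding word_append_def by (intro cmp_intros)

lemma cmp_word_star [cmp_intros]:
  assumes "cmp f" shows "cmp (\<lambda>x. word_star (f x))"
  unfolding word_star_def letter_star_def by (intro cmp_intros assms)

lemma cmp_code_smult [cmp_intros]:
  assumes "cmp f" "cmp g" shows "cmp (\<lambda>x. code_smult (f x) (g x))"
proof -
  have "cmp (\<lambda>p. code_smult (fst p) (snd p))"
    unfolding code_smult_def by (intro cmp_intros)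
  from cmp_comp2[where f = code_smult, OF this assms] show ?thesis .
qed

lemma cmp_code_mult [cmp_intros]:
  assumes "cmp f" "cmp g" shows "cmp (\<lambda>x. code_mult (f x) (g x))"
proof -
  have "cmp (\<lambda>p. code_mult (fst p) (snd p))"
    unfolding code_mult_def by (intro cmp_intros)
  from cmp_comp2[where f = code_mult, OF this assms] show ?thesis .
qed

lemma cmp_code_star [cmp_intros]: "cmp f \<Longrightarrow> cmp (\<lambda>x. code_star (f x))"
  unfolding code_star_def by (intro cmp_intros)

lemma cmp_code_subst [cmp_intros]:
  assumes "cmp (\<lambda>p. \<sigma> (fst p) (snd p))" "cmp P"
  shows "cmp (\<lambda>x. code_subst (\<sigma> x) (P x))"
  unfolding code_subst_def word_subst_def letter_subst_def
  by (intro cmp_intros assms(2) cmp_comp2[where f = \<sigma>, OF assms(1)])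

text \<open>Every number codes a pair \<open>(i, t)\<close>. It is mapped to \<open>i\<close> if the
  test succeeds and to a fixed element \<open>i0\<close> of the set otherwise, which is why the
  empty set is treated apart.\<close>

lemma ce_setI:
  assumes "cmpp (\<lambda>p. P (fst p) (snd p :: 'a :: coded))"
  shows "ce_set {i. \<exists>t. P i t}"
proof (cases "{i. \<exists>t. P i t} = {}")
  case False
  then obtain i0 t0 where i0: "P i0 t0" by auto
  have "cmp (\<lambda>p. if P (fst p) (snd p) then fst p else i0)"
    by (intro cmp_intros assms)
  then have "computable (\<lambda>n. case dec n :: nat \<times> 'a of (i, t) \<Rightarrow> if P i t then i else i0)"
    (is "computable ?h")
    by (simp add: cmp_def enc_nat_def case_prod_beta)
  moreover have "{i. \<exists>t. P i t} = range ?h"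
  proof
    show "range ?h \<subseteq> {i. \<exists>t. P i t}" using i0 by (auto split: prod.splits)
    show "{i. \<exists>t. P i t} \<subseteq> range ?h"
    proof clarify
      fix i t assume "P i t"
      then have "?h (enc (i, t)) = i" by simp
      from this[symmetric] show "i \<in> range ?h" by (rule range_eqI)
    qed
  qed
  ultimately show ?thesis unfolding ce_set_def by blast
qed (simp add: ce_set_def)

section \<open>Norms, limits and evaluation of *-polynomials\<close>

lemma complex_ring_simps [simp]:
  "carrier complex_ring = UNIV" "\<zero>\<^bsub>complex_ring\<^esub> = 0" "\<one>\<^bsub>complex_ring\<^esub> = 1"
  "x \<oplus>\<^bsub>complex_ring\<^esub> y = x + y" "x \<otimes>\<^bsub>complex_ring\<^esub> y = x * y"
  by (simp_all add: complex_ring_def)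

text \<open>Distances and limits involve only addition and the norm. At this level they apply alike
  to the algebra, to its transported copy and to its powers.\<close>

locale normed_group = abelian_group B for B :: "('a, 'm) cstar_scheme" (structure) +
  assumes norm_nonneg: "x \<in> carrier B \<Longrightarrow> 0 \<le> cnorm B x"
    and norm_eq_0_iff: "x \<in> carrier B \<Longrightarrow> cnorm B x = 0 \<longleftrightarrow> x = \<zero>"
    and norm_triangle: "\<lbrakk>x \<in> carrier B; y \<in> carrier B\<rbrakk> \<Longrightarrow> cnorm B (x \<oplus> y) \<le> cnorm B x + cnorm B y"
    and norm_uminus: "x \<in> carrier B \<Longrightarrow> cnorm B (\<ominus> x) = cnorm B x"
begin

lemma minus_commute_norm: "\<lbrakk>x \<in> carrier B; y \<in> carrier B\<rbrakk> \<Longrightarrow> cnorm B (x \<ominus> y) = cnorm B (y \<ominus> x)"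
  using norm_uminus[of "x \<ominus> y"] by (simp add: a_minus_def minus_add a_comm)

lemma minus_chain:
  assumes "x \<in> carrier B" "y \<in> carrier B" "z \<in> carrier B"
  shows "(x \<ominus> y) \<oplus> (y \<ominus> z) = x \<ominus> z"
proof -
  have "(x \<ominus> y) \<oplus> (y \<ominus> z) = x \<oplus> ((\<ominus> y \<oplus> y) \<oplus> \<ominus> z)"
    using assms by (simp add: a_minus_def a_assoc del: l_neg)
  then show ?thesis using assms by (simp add: a_minus_def l_neg)
qed

lemma norm_minus_triangle:
  assumes "x \<in> carrier B" "y \<in> carrier B" "z \<in> carrier B"
  shows "cnorm B (x \<ominus> z) \<le> cnorm B (x \<ominus> y) + cnorm B (y \<ominus> z)"
  using norm_triangle[of "x \<ominus> y" "y \<ominus> z"] minus_chain[OF assms] assms by simp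

lemma minus_zero [simp]: "x \<in> carrier B \<Longrightarrow> x \<ominus> \<zero> = x"
  by (simp add: a_minus_def)

lemma minus_self: "x \<in> carrier B \<Longrightarrow> x \<ominus> x = \<zero>"
  by (simp add: a_minus_def r_neg)

lemma minus_eq_0_iff: "\<lbrakk>x \<in> carrier B; y \<in> carrier B\<rbrakk> \<Longrightarrow> x \<ominus> y = \<zero> \<longleftrightarrow> x = y"
  by (metis a_minus_def add.inv_closed add.inv_solve_right l_zero zero_closed)

lemma norm_le_minus:
  "\<lbrakk>x \<in> carrier B; y \<in> carrier B\<rbrakk> \<Longrightarrow> cnorm B x \<le> cnorm B (x \<ominus> y) + cnorm B y"
  using norm_minus_triangle[of x y \<zero>] by simp

lemma metric: "Metric_space (carrier B) (cdist B)"
proof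
  fix x y z
  show "0 \<le> cdist B x y"
    by (simp add: cdist_def norm_nonneg)
  show "cdist B x y = cdist B y x"
    by (simp add: cdist_def minus_commute_norm)
  show "cdist B x y = 0 \<longleftrightarrow> x = y" if "x \<in> carrier B" "y \<in> carrier B"
    using that by (simp add: cdist_def norm_eq_0_iff minus_eq_0_iff)
  show "cdist B x z \<le> cdist B x y + cdist B y z"
    if "x \<in> carrier B" "y \<in> carrier B" "z \<in> carrier B"
    using that by (simp add: cdist_def norm_minus_triangle)
qed

definition conv :: "(nat \<Rightarrow> 'a) \<Rightarrow> 'a \<Rightarrow> bool" where
  "conv x l \<longleftrightarrow> range x \<subseteq> carrier B \<and> l \<in> carrier B \<and> (\<lambda>i. cnorm B (x i \<ominus> l)) \<longlonglongrightarrow> 0"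

lemma conv_closed: "conv x l \<Longrightarrow> x i \<in> carrier B" "conv x l \<Longrightarrow> l \<in> carrier B"
  by (auto simp: conv_def)

lemma norm_zero [simp]: "cnorm B \<zero> = 0"
  by (simp add: norm_eq_0_iff)

lemma conv_const: "l \<in> carrier B \<Longrightarrow> conv (\<lambda>i. l) l"
  by (auto simp: conv_def minus_self)

lemma conv_norm:
  assumes "conv x l" shows "(\<lambda>i. cnorm B (x i)) \<longlonglongrightarrow> cnorm B l"
proof -
  note c = conv_closed[OF assms]
  have "\<bar>cnorm B (x i) - cnorm B l\<bar> \<le> cnorm B (x i \<ominus> l)" for i
    using norm_le_minus[of "x i" l] norm_le_minus[of l "x i"] minus_commute_norm[of l "x i"] c
    by (simp add: abs_le_iff)
  moreover have "(\<lambda>i. cnorm B (x i \<ominus> l)) \<longlonglongrightarrow> 0" using assms by (simp add: conv_def)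
  ultimately have "(\<lambda>i. cnorm B (x i) - cnorm B l) \<longlonglongrightarrow> 0"
    by (intro Lim_null_comparison[of "\<lambda>i. cnorm B (x i) - cnorm B l" "\<lambda>i. cnorm B (x i \<ominus> l)"]
        always_eventually allI) simp_all
  then show ?thesis by (simp add: LIM_zero_iff)
qed

lemma convI:
  assumes "\<And>i. x i \<in> carrier B" "l \<in> carrier B" "\<And>i. cnorm B (x i \<ominus> l) \<le> e i" "e \<longlonglongrightarrow> 0"
  shows "conv x l"
  unfolding conv_def
proof (intro conjI)
  show "(\<lambda>i. cnorm B (x i \<ominus> l)) \<longlonglongrightarrow> 0"
    using assms(1-3)
    by (intro tendsto_sandwich[OF _ _ tendsto_const assms(4)] always_eventually allI norm_nonneg) auto
qed (use assms in auto)

lemma conv_add: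
  assumes "conv x a" "conv y b" shows "conv (\<lambda>i. x i \<oplus> y i) (a \<oplus> b)"
proof (rule convI)
  note c = conv_closed[OF assms(1)] conv_closed[OF assms(2)]
  show "x i \<oplus> y i \<in> carrier B" "a \<oplus> b \<in> carrier B" for i using c by auto
  show "cnorm B ((x i \<oplus> y i) \<ominus> (a \<oplus> b)) \<le> cnorm B (x i \<ominus> a) + cnorm B (y i \<ominus> b)" for i
  proof -
    have "(x i \<oplus> y i) \<ominus> (a \<oplus> b) = (x i \<ominus> a) \<oplus> (y i \<ominus> b)"
      using c by (simp add: a_minus_def minus_add a_ac)
    then show ?thesis using norm_triangle[of "x i \<ominus> a" "y i \<ominus> b"] c by simp
  qed
  show "(\<lambda>i. cnorm B (x i \<ominus> a) + cnorm B (y i \<ominus> b)) \<longlonglongrightarrow> 0"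
    using assms by (auto simp: conv_def intro: tendsto_add_zero)
qed

lemma conv_unique:
  assumes "conv x a" "conv x b" shows "a = b"
proof -
  note c = conv_closed[OF assms(1)] conv_closed[OF assms(2)]
  have "cnorm B (a \<ominus> b) \<le> cnorm B (x i \<ominus> a) + cnorm B (x i \<ominus> b)" for i
    using norm_minus_triangle[of a "x i" b] minus_commute_norm[of a "x i"] c by simp
  moreover have "(\<lambda>i. cnorm B (x i \<ominus> a) + cnorm B (x i \<ominus> b)) \<longlonglongrightarrow> 0"
    using assms by (auto simp: conv_def intro: tendsto_add_zero)
  ultimately have "cnorm B (a \<ominus> b) \<le> 0"
    by (intro LIMSEQ_le_const) auto
  then show ?thesis
    using norm_nonneg[of "a \<ominus> b"] norm_eq_0_iff[of "a \<ominus> b"] minus_eq_0_iff[of a b] c by auto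
qed

text \<open>Closedness is a topological statement, while the rules for sums, products and adjoints
  are stated for \<open>conv\<close>.\<close>

lemma limitin_iff_conv:
  assumes "range x \<subseteq> carrier B"
  shows "limitin (Metric_space.mtopology (carrier B) (cdist B)) x l sequentially \<longleftrightarrow> conv x l"
proof -
  interpret M: Metric_space "carrier B" "cdist B" by (rule metric)
  have "l \<in> carrier B \<Longrightarrow> (\<lambda>i. cdist B (x i) l) = (\<lambda>i. cnorm B (x i \<ominus> l))"
    using assms by (auto simp: cdist_def fun_eq_iff)
  then show ?thesis
    using assms unfolding M.limitin_metric_dist_null conv_def by (auto intro!: always_eventually)
qed

end

text \<open>
  Just enough structure to evaluate *-polynomials, so that the powers of an algebra need not be
  shown to be C*-algebras.
\<close>

locale star_structure = abelian_monoid B for B :: "('a, 'm) cstar_scheme" (structure) +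
  assumes mult_in: "\<lbrakk>x \<in> carrier B; y \<in> carrier B\<rbrakk> \<Longrightarrow> x \<otimes> y \<in> carrier B"
    and star_in: "x \<in> carrier B \<Longrightarrow> star B x \<in> carrier B"
    and smult_in: "x \<in> carrier B \<Longrightarrow> c \<odot> x \<in> carrier B"
begin

lemma letter_val_in: "v (fst l) \<in> carrier B \<Longrightarrow> letter_val B v l \<in> carrier B"
  by (cases l) (auto intro: star_in)

lemma word_val_in:
  "\<lbrakk>\<And>j. j \<in> fst ` set u \<Longrightarrow> v j \<in> carrier B; u = [] \<Longrightarrow> \<one> \<in> carrier B\<rbrakk>
    \<Longrightarrow> word_val B v u \<in> carrier B"
proof (induction u rule: induct_list012)
  case (2 l) then show ?case by (simp add: letter_val_in del: letter_val.simps)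
next
  case (3 l l' ls) then show ?case by (simp add: letter_val_in mult_in del: letter_val.simps)
qed simp

end

lemma word_val_hom:
  assumes "star_structure B"
    and hom: "\<And>x y. \<lbrakk>x \<in> carrier B; y \<in> carrier B\<rbrakk> \<Longrightarrow> \<phi> (x \<otimes>\<^bsub>B\<^esub> y) = \<phi> x \<otimes>\<^bsub>C\<^esub> \<phi> y"
      "\<And>x. x \<in> carrier B \<Longrightarrow> \<phi> (star B x) = star C (\<phi> x)"
  shows "\<lbrakk>\<And>j. j \<in> fst ` set u \<Longrightarrow> v j \<in> carrier B \<and> w j = \<phi> (v j);
      u = [] \<Longrightarrow> \<phi> \<one>\<^bsub>B\<^esub> = \<one>\<^bsub>C\<^esub>\<rbrakk> \<Longrightarrow> word_val C w u = \<phi> (word_val B v u)"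
proof (induction u rule: induct_list012)
  case (2 l) then show ?case by (cases l) (auto simp: hom)
next
  case (3 l l' ls)
  interpret star_structure B by fact
  have "letter_val C w l = \<phi> (letter_val B v l)"
    using 3(3)[of "fst l"] by (cases l) (auto simp: hom)
  moreover have "letter_val B v l \<in> carrier B"
    using 3(3)[of "fst l"] by (intro letter_val_in) auto
  moreover have "word_val B v (l' # ls) \<in> carrier B"
    using 3(3) by (intro word_val_in) auto
  moreover have "word_val C w (l' # ls) = \<phi> (word_val B v (l' # ls))"
    using 3(3) by (intro 3(2)) auto
  ultimately show ?case by (simp add: hom)
qed simp

text \<open>Serves for three maps: the bijection onto a transported copy, the coordinate projections
  of a power, and the identity, where it says that only the entries at \<open>poly_vars p\<close>
  matter.\<close>

lemma poly_val_hom: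
  assumes B: "star_structure B" and C: "star_structure C"
    and closed: "\<And>x. x \<in> carrier B \<Longrightarrow> \<phi> x \<in> carrier C"
    and hom: "\<And>x y. \<lbrakk>x \<in> carrier B; y \<in> carrier B\<rbrakk> \<Longrightarrow> \<phi> (x \<otimes>\<^bsub>B\<^esub> y) = \<phi> x \<otimes>\<^bsub>C\<^esub> \<phi> y"
      "\<And>x. x \<in> carrier B \<Longrightarrow> \<phi> (star B x) = star C (\<phi> x)"
      "\<And>x y. \<lbrakk>x \<in> carrier B; y \<in> carrier B\<rbrakk> \<Longrightarrow> \<phi> (x \<oplus>\<^bsub>B\<^esub> y) = \<phi> x \<oplus>\<^bsub>C\<^esub> \<phi> y"
      "\<phi> \<zero>\<^bsub>B\<^esub> = \<zero>\<^bsub>C\<^esub>"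
      "\<And>c x. x \<in> carrier B \<Longrightarrow> \<phi> (c \<odot>\<^bsub>B\<^esub> x) = c \<odot>\<^bsub>C\<^esub> \<phi> x"
    and v: "\<And>j. j \<in> poly_vars p \<Longrightarrow> v j \<in> carrier B \<and> w j = \<phi> (v j)"
    and one: "Poly_Mapping.lookup p [] \<noteq> 0 \<Longrightarrow> \<one>\<^bsub>B\<^esub> \<in> carrier B \<and> \<phi> \<one>\<^bsub>B\<^esub> = \<one>\<^bsub>C\<^esub>"
  shows "poly_val C w p = \<phi> (poly_val B v p)" "poly_val B v p \<in> carrier B"
proof -
  interpret B: star_structure B by fact
  interpret C: star_structure C by fact
  have wB: "word_val B v u \<in> carrier B" and wC: "word_val C w u = \<phi> (word_val B v u)"
    if "u \<in> Poly_Mapping.keys p" for u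
  proof -
    have "\<And>j. j \<in> fst ` set u \<Longrightarrow> v j \<in> carrier B \<and> w j = \<phi> (v j)"
      using v that by (auto simp: poly_vars_def)
    moreover have "u = [] \<Longrightarrow> \<one>\<^bsub>B\<^esub> \<in> carrier B \<and> \<phi> \<one>\<^bsub>B\<^esub> = \<one>\<^bsub>C\<^esub>"
      using one that by (simp add: in_keys_iff)
    ultimately show "word_val B v u \<in> carrier B" "word_val C w u = \<phi> (word_val B v u)"
      by (auto intro!: B.word_val_in word_val_hom[OF B] hom)
  qed
  have *: "(\<Oplus>\<^bsub>C\<^esub>u\<in>S. Poly_Mapping.lookup p u \<odot>\<^bsub>C\<^esub> word_val C w u) =
      \<phi> (\<Oplus>\<^bsub>B\<^esub>u\<in>S. Poly_Mapping.lookup p u \<odot>\<^bsub>B\<^esub> word_val B v u) \<and>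
      (\<Oplus>\<^bsub>B\<^esub>u\<in>S. Poly_Mapping.lookup p u \<odot>\<^bsub>B\<^esub> word_val B v u) \<in> carrier B"
    if "finite S" "S \<subseteq> Poly_Mapping.keys p" for S
    using that
  proof (induction S)
    case empty then show ?case by (simp add: hom)
  next
    case (insert u S)
    then have u: "word_val B v u \<in> carrier B" "word_val C w u = \<phi> (word_val B v u)"
      using wB wC by auto
    have S: "word_val B v x \<in> carrier B" "word_val C w x = \<phi> (word_val B v x)" if "x \<in> S" for x
      using insert that wB wC by auto
    show ?case
      using insert u S by (simp add: Pi_def B.smult_in C.smult_in closed hom)
  qed
  from *[of "Poly_Mapping.keys p"] show "poly_val C w p = \<phi> (poly_val B v p)"
    "poly_val B v p \<in> carrier B"
    by (simp_all add: poly_val_def)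
qed

section \<open>Arithmetic and limits in a C*-algebra; continuity of *-polynomials\<close>

context cstar_algebra
begin

lemma smult_add_left: "x \<in> carrier B \<Longrightarrow> (a + b) \<odot> x = a \<odot> x \<oplus> b \<odot> x"
  using smult_l_distr[of a b x] by simp

lemma smult_add_right: "\<lbrakk>x \<in> carrier B; y \<in> carrier B\<rbrakk> \<Longrightarrow> a \<odot> (x \<oplus> y) = a \<odot> x \<oplus> a \<odot> y"
  using smult_r_distr[of a x y] by simp

lemma smult_smult: "x \<in> carrier B \<Longrightarrow> a \<odot> (b \<odot> x) = (a * b) \<odot> x"
  using smult_assoc1[of a b x] by simp

lemma smult_zero_left [simp]: "x \<in> carrier B \<Longrightarrow> 0 \<odot> x = \<zero>"
  using smult_l_null[of x] by simp

lemma smult_zero_right [simp]: "c \<odot> \<zero> = \<zero>"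
  using smult_r_null[of c] by simp

lemma smult_one_left [simp]: "x \<in> carrier B \<Longrightarrow> 1 \<odot> x = x"
  using smult_one[of x] by simp

lemma smult_m1: "x \<in> carrier B \<Longrightarrow> (- 1) \<odot> x = \<ominus> x"
  using smult_add_left[of x "- 1" 1] by (intro M.minus_equality[symmetric]) simp_all

lemma minus_smult: "\<lbrakk>x \<in> carrier B; y \<in> carrier B\<rbrakk> \<Longrightarrow> x \<ominus> y = x \<oplus> (- 1) \<odot> y"
  by (simp add: a_minus_def smult_m1)

end

sublocale cstar_algebra \<subseteq> normed_group
proof unfold_locales
  show "cnorm B (\<ominus> x) = cnorm B x" if "x \<in> carrier B" for x
    using cnorm_smult[of x "- 1"] that by (simp add: smult_m1)
qed (auto intro: cnorm_nonneg cnorm_triangle simp: cnorm_eq_0_iff)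

sublocale cstar_algebra \<subseteq> star_structure
  by unfold_locales (auto intro: mult_closed star_closed)

context cstar_algebra
begin

lemma star_zero [simp]: "star B \<zero> = \<zero>"
  using star_smult[of \<zero> 0] by (simp add: star_closed)

lemma star_uminus: "x \<in> carrier B \<Longrightarrow> star B (\<ominus> x) = \<ominus> star B x"
  using star_smult[of x "- 1"] by (simp add: smult_m1 star_closed)

lemma star_minus: "\<lbrakk>x \<in> carrier B; y \<in> carrier B\<rbrakk> \<Longrightarrow> star B (x \<ominus> y) = star B x \<ominus> star B y"
  by (simp add: a_minus_def star_add star_uminus)

lemma mult_zero_right [simp]: "x \<in> carrier B \<Longrightarrow> x \<otimes> \<zero> = \<zero>"
  using mult_smult_r[of x \<zero> 0] by (simp add: mult_closed)

lemma mult_zero_left [simp]: "x \<in> carrier B \<Longrightarrow> \<zero> \<otimes> x = \<zero>"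
  using mult_smult_l[of \<zero> x 0] by (simp add: mult_closed)

lemma mult_minus_left:
  "\<lbrakk>x \<in> carrier B; y \<in> carrier B; z \<in> carrier B\<rbrakk> \<Longrightarrow> (x \<ominus> y) \<otimes> z = x \<otimes> z \<ominus> y \<otimes> z"
  by (simp add: minus_smult mult_l_distr mult_smult_l mult_closed)

lemma mult_minus_right:
  "\<lbrakk>x \<in> carrier B; y \<in> carrier B; z \<in> carrier B\<rbrakk> \<Longrightarrow> z \<otimes> (x \<ominus> y) = z \<otimes> x \<ominus> z \<otimes> y"
  by (simp add: minus_smult mult_r_distr mult_smult_r mult_closed)

text \<open>The C*-identity and submultiplicativity bound the square of \<open>cnorm B x\<close> by
  \<open>cnorm B (star B x) * cnorm B x\<close>. Cancelling gives one inequality, and the same for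
  the adjoint gives the other.\<close>

lemma cnorm_star: assumes "x \<in> carrier B" shows "cnorm B (star B x) = cnorm B x"
proof -
  have le: "cnorm B x \<le> cnorm B (star B x)" if x: "x \<in> carrier B" for x
  proof (cases "cnorm B x = 0")
    case False
    have "cnorm B x * cnorm B x \<le> cnorm B (star B x) * cnorm B x"
      using cstar_identity[OF x] cnorm_mult[OF star_closed[OF x] x] by (simp add: power2_eq_square)
    then show ?thesis using False cnorm_nonneg[OF x] by simp
  qed (use cnorm_nonneg[OF star_closed[OF x]] in simp)
  from le[OF assms] le[OF star_closed[OF assms]] show ?thesis
    by (simp add: star_star assms)
qed

lemma conv_star: assumes "conv x a" shows "conv (\<lambda>i. star B (x i)) (star B a)"
proof -
  note c = conv_closed[OF assms]
  have "cnorm B (star B (x i) \<ominus> star B a) = cnorm B (x i \<ominus> a)" for i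
    using c by (simp add: star_minus[symmetric] cnorm_star)
  then show ?thesis using assms c by (auto simp: conv_def star_closed)
qed

lemma conv_mult:
  assumes "conv x a" "conv y b" shows "conv (\<lambda>i. x i \<otimes> y i) (a \<otimes> b)"
proof (rule convI)
  note c = conv_closed[OF assms(1)] conv_closed[OF assms(2)]
  show "x i \<otimes> y i \<in> carrier B" "a \<otimes> b \<in> carrier B" for i using c by (auto intro: mult_closed)
  show "cnorm B ((x i \<otimes> y i) \<ominus> (a \<otimes> b)) \<le>
      cnorm B (x i \<ominus> a) * cnorm B (y i) + cnorm B a * cnorm B (y i \<ominus> b)" for i
  proof -
    \<comment> \<open>Passing through \<open>a \<otimes> y i\<close> leaves a single differing
      factor in each summand; the other factor \<open>cnorm B (y i)\<close> converges.\<close>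
    have "cnorm B ((x i \<otimes> y i) \<ominus> (a \<otimes> b)) \<le>
        cnorm B ((x i \<otimes> y i) \<ominus> (a \<otimes> y i)) + cnorm B ((a \<otimes> y i) \<ominus> (a \<otimes> b))"
      using c by (intro norm_minus_triangle mult_closed)
    also have "\<dots> = cnorm B ((x i \<ominus> a) \<otimes> y i) + cnorm B (a \<otimes> (y i \<ominus> b))"
      using c by (simp add: mult_minus_left mult_minus_right)
    also have "\<dots> \<le> cnorm B (x i \<ominus> a) * cnorm B (y i) + cnorm B a * cnorm B (y i \<ominus> b)"
      using c by (intro add_mono cnorm_mult) auto
    finally show ?thesis .
  qed
  have "(\<lambda>i. cnorm B (x i \<ominus> a) * cnorm B (y i) + cnorm B a * cnorm B (y i \<ominus> b))
      \<longlonglongrightarrow> 0 * cnorm B b + cnorm B a * 0"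
    using assms conv_norm[OF assms(2)] unfolding conv_def by (intro tendsto_intros) auto
  then show "(\<lambda>i. cnorm B (x i \<ominus> a) * cnorm B (y i) + cnorm B a * cnorm B (y i \<ominus> b)) \<longlonglongrightarrow> 0"
    by simp
qed

text \<open>The scalars vary as well, because complex scalars are going to be approximated by
  Gaussian rationals.\<close>

lemma conv_smult:
  assumes "c \<longlonglongrightarrow> d" "conv x a" shows "conv (\<lambda>i. c i \<odot> x i) (d \<odot> a)"
proof (rule convI)
  note cl = conv_closed[OF assms(2)]
  show "c i \<odot> x i \<in> carrier B" "d \<odot> a \<in> carrier B" for i using cl by auto
  show "cnorm B ((c i \<odot> x i) \<ominus> (d \<odot> a)) \<le>
      cmod (c i) * cnorm B (x i \<ominus> a) + cmod (c i - d) * cnorm B a" for i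
  proof -
    have "cnorm B ((c i \<odot> x i) \<ominus> (d \<odot> a)) \<le>
        cnorm B ((c i \<odot> x i) \<ominus> (c i \<odot> a)) + cnorm B ((c i \<odot> a) \<ominus> (d \<odot> a))"
      using cl by (intro norm_minus_triangle) auto
    also have "(c i \<odot> x i) \<ominus> (c i \<odot> a) = c i \<odot> (x i \<ominus> a)"
      using cl by (simp add: minus_smult smult_add_right smult_smult)
    also have "(c i \<odot> a) \<ominus> (d \<odot> a) = (c i - d) \<odot> a"
      using cl smult_add_left[of a "c i" "- d"] by (simp add: minus_smult smult_smult)
    finally show ?thesis using cl by (simp add: cnorm_smult)
  qed
  have "(\<lambda>i. cmod (c i) * cnorm B (x i \<ominus> a) + cmod (c i - d) * cnorm B a)
      \<longlonglongrightarrow> cmod d * 0 + cmod (d - d) * cnorm B a"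
    using assms unfolding conv_def by (intro tendsto_intros) auto
  then show "(\<lambda>i. cmod (c i) * cnorm B (x i \<ominus> a) + cmod (c i - d) * cnorm B a) \<longlonglongrightarrow> 0"
    by simp
qed

lemma conv_word_val:
  "\<lbrakk>\<And>j. j \<in> fst ` set u \<Longrightarrow> conv (\<lambda>i. w i j) (z j); u = [] \<Longrightarrow> \<one> \<in> carrier B\<rbrakk>
    \<Longrightarrow> conv (\<lambda>i. word_val B (w i) u) (word_val B z u)"
proof (induction u rule: induct_list012)
  case 1 then show ?case by (simp add: conv_const)
next
  case (2 l) then show ?case by (cases l) (auto intro: conv_star)
next
  case (3 l l' ls)
  have "conv (\<lambda>i. letter_val B (w i) l) (letter_val B z l)"
    using 3(3)[of "fst l"] by (cases l) (auto intro: conv_star)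
  then show ?case using 3 by (auto intro!: conv_mult)
qed

text \<open>This continuity is used twice: to see that the solution set is closed, and to see that
  rational points near a solution have small defect.\<close>

lemma conv_poly_val:
  assumes "\<And>j. j \<in> poly_vars p \<Longrightarrow> conv (\<lambda>i. w i j) (z j)"
    and "Poly_Mapping.lookup p [] \<noteq> 0 \<Longrightarrow> \<one> \<in> carrier B"
  shows "conv (\<lambda>i. poly_val B (w i) p) (poly_val B z p)"
proof -
  have W: "conv (\<lambda>i. word_val B (w i) u) (word_val B z u)" if "u \<in> Poly_Mapping.keys p" for u
  proof (rule conv_word_val)
    show "conv (\<lambda>i. w i j) (z j)" if "j \<in> fst ` set u" for j
      using assms(1) \<open>u \<in> Poly_Mapping.keys p\<close> that by (auto simp: poly_vars_def)
    show "\<one> \<in> carrier B" if "u = []"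
      using assms(2) \<open>u \<in> Poly_Mapping.keys p\<close> that by (simp add: in_keys_iff)
  qed
  have "conv (\<lambda>i. \<Oplus>u\<in>S. Poly_Mapping.lookup p u \<odot> word_val B (w i) u)
      (\<Oplus>u\<in>S. Poly_Mapping.lookup p u \<odot> word_val B z u)"
    if "finite S" "S \<subseteq> Poly_Mapping.keys p" for S
    using that
  proof (induction S)
    case (insert u S)
    note c = conv_closed[OF W]
    have "conv (\<lambda>i. Poly_Mapping.lookup p u \<odot> word_val B (w i) u)
        (Poly_Mapping.lookup p u \<odot> word_val B z u)"
      using insert by (intro conv_smult W tendsto_const) auto
    moreover have "x \<in> Poly_Mapping.keys p" if "x \<in> insert u S" for x
      using insert that by auto
    ultimately show ?case
      using insert c by (subst (1 2) finsum_insert) (auto intro!: conv_add)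
  qed (simp add: conv_const)
  from this[of "Poly_Mapping.keys p"] show ?thesis by (simp add: poly_val_def)
qed

end

section \<open>Evaluation of codes\<close>

text \<open>Equal words are not collected, so identities between codes are proved by induction on
  lists instead of by manipulating finite sums over supports.\<close>

definition code_val :: "('a, 'm) cstar_scheme \<Rightarrow> (nat \<Rightarrow> 'a) \<Rightarrow> poly_code \<Rightarrow> 'a" where
  "code_val B v P =
    foldr (\<lambda>m x. gaussian_val (fst m) \<odot>\<^bsub>B\<^esub> word_val B v (word_of (snd m)) \<oplus>\<^bsub>B\<^esub> x) P \<zero>\<^bsub>B\<^esub>"

lemma code_val_simps [simp]:
  "code_val B v [] = \<zero>\<^bsub>B\<^esub>"
  "code_val B v (m # P) =
    gaussian_val (fst m) \<odot>\<^bsub>B\<^esub> word_val B v (word_of (snd m)) \<oplus>\<^bsub>B\<^esub> code_val B v P"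
  by (simp_all add: code_val_def)

lemma word_of_not_Nil [simp]: "word_of u \<noteq> []" "[] \<noteq> word_of u"
  by (simp_all add: word_of_def)

lemma word_of_append: "word_of (word_append u v) = word_of u @ word_of v"
  by (simp add: word_of_def word_append_def)

lemma letter_decode_star: "letter_decode (letter_star n) = apsnd Not (letter_decode n)"
  by (auto simp: letter_decode_def letter_star_def elim: oddE)

lemma word_of_star: "word_of (word_star u) = rev (map (apsnd Not) (word_of u))"
proof -
  have "word_of (word_star u) = map letter_decode (rev (map letter_star (fst u # snd u)))"
  proof (cases "rev (map letter_star (fst u # snd u))")
    case (Cons l ls)
    then show ?thesis by (simp add: word_star_def word_of_def)
  qed simp
  then show ?thesis
    by (simp add: word_of_def rev_map letter_decode_star)
qed

text \<open>Bridges a gap between two notions: \<open>star_subalgebra\<close> admits all complex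
  scalars, rational points only Gaussian rational ones.\<close>

lemma gaussian_rational_limit: "\<exists>c. (\<lambda>i. gaussian_val (c i)) \<longlonglongrightarrow> z"
proof -
  have "\<exists>q. (\<lambda>i. real_of_rat (rat_val (q i))) \<longlonglongrightarrow> x" for x :: real
  proof -
    have "\<exists>q. \<bar>real_of_rat (rat_val q) - x\<bar> < 1 / real (Suc i)" for i
    proof -
      obtain r where r: "x < real_of_rat r" "real_of_rat r < x + 1 / real (Suc i)"
        using of_rat_dense[of x "x + 1 / real (Suc i)"] by auto
      obtain n where "r = rat_decode n"
        using range_rat_decode by (metis UNIV_I imageE)
      then have "\<bar>real_of_rat (rat_val (dec n)) - x\<bar> < 1 / real (Suc i)"
        using r by (simp add: rat_decode_eq)
      then show ?thesis by blast
    qed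
    then obtain q where q: "\<And>i. \<bar>real_of_rat (rat_val (q i)) - x\<bar> < 1 / real (Suc i)"
      by metis
    have "(\<lambda>i. 1 / real (Suc i)) \<longlonglongrightarrow> 0"
      using LIMSEQ_inverse_real_of_nat by (simp add: inverse_eq_divide)
    then have "(\<lambda>i. real_of_rat (rat_val (q i)) - x) \<longlonglongrightarrow> 0"
      by (rule Lim_null_comparison[rotated]) (use q in \<open>auto intro!: always_eventually less_imp_le simp del: of_nat_Suc\<close>)
    then show ?thesis by (auto simp: LIM_zero_iff)
  qed
  then obtain p q where "(\<lambda>i. real_of_rat (rat_val (p i))) \<longlonglongrightarrow> Re z"
    "(\<lambda>i. real_of_rat (rat_val (q i))) \<longlonglongrightarrow> Im z"
    by metis
  then have "(\<lambda>i. gaussian_val (p i, q i)) \<longlonglongrightarrow> z"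
    by (simp add: tendsto_complex_iff gaussian_val_def)
  then show ?thesis by (rule exI[where x = "\<lambda>i. (p i, q i)"])
qed

context cstar_algebra
begin

text \<open>Coefficients may cancel in \<open>p + q\<close>, so its support can be smaller than the
  union of the supports; padding with zero terms lets all three sums run over that union.\<close>

lemma poly_val_superset:
  assumes "finite S" "Poly_Mapping.keys p \<subseteq> S" "\<And>u. u \<in> S \<Longrightarrow> word_val B v u \<in> carrier B"
  shows "poly_val B v p = (\<Oplus>u\<in>S. Poly_Mapping.lookup p u \<odot> word_val B v u)"
  unfolding poly_val_def
  by (rule M.add.finprod_mono_neutral_cong_left) (use assms in \<open>auto simp: in_keys_iff\<close>)

lemma poly_val_add:
  assumes "\<And>u. u \<in> Poly_Mapping.keys p \<union> Poly_Mapping.keys q \<Longrightarrow> word_val B v u \<in> carrier B"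
  shows "poly_val B v (p + q) = poly_val B v p \<oplus> poly_val B v q"
proof -
  let ?S = "Poly_Mapping.keys p \<union> Poly_Mapping.keys q"
  have "poly_val B v (p + q) = (\<Oplus>u\<in>?S. Poly_Mapping.lookup (p + q) u \<odot> word_val B v u)"
    by (rule poly_val_superset) (use assms keys_add[of p q] in auto)
  also have "\<dots> = (\<Oplus>u\<in>?S. Poly_Mapping.lookup p u \<odot> word_val B v u \<oplus>
      Poly_Mapping.lookup q u \<odot> word_val B v u)"
    using assms by (intro finsum_cong') (auto simp: lookup_add smult_add_left)
  also have "\<dots> = (\<Oplus>u\<in>?S. Poly_Mapping.lookup p u \<odot> word_val B v u) \<oplus>
      (\<Oplus>u\<in>?S. Poly_Mapping.lookup q u \<odot> word_val B v u)"
    using assms by (intro finsum_addf) auto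
  also have "(\<Oplus>u\<in>?S. Poly_Mapping.lookup p u \<odot> word_val B v u) = poly_val B v p"
    by (rule poly_val_superset[symmetric]) (use assms in auto)
  also have "(\<Oplus>u\<in>?S. Poly_Mapping.lookup q u \<odot> word_val B v u) = poly_val B v q"
    by (rule poly_val_superset[symmetric]) (use assms in auto)
  finally show ?thesis .
qed

lemma poly_val_single:
  assumes "word_val B v u \<in> carrier B"
  shows "poly_val B v (Poly_Mapping.single u c) = c \<odot> word_val B v u"
proof -
  have "poly_val B v (Poly_Mapping.single u c) =
      (\<Oplus>u'\<in>{u}. Poly_Mapping.lookup (Poly_Mapping.single u c) u' \<odot> word_val B v u')"
    using assms by (intro poly_val_superset) auto
  also have "\<dots> = c \<odot> word_val B v u"
    using assms by simp
  finally show ?thesis .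
qed

lemma code_val_in:
  assumes "\<And>j. v j \<in> carrier B" shows "code_val B v P \<in> carrier B"
proof -
  have "word_val B v (word_of u) \<in> carrier B" for u
    by (intro word_val_in) (auto simp: assms)
  then show ?thesis by (induction P) simp_all
qed

lemma poly_val_poly_of:
  assumes v: "\<And>j. v j \<in> carrier B"
  shows "poly_val B v (poly_of P) = code_val B v P"
proof (induction P)
  case Nil then show ?case by (simp add: poly_of_def poly_val_def)
next
  case (Cons m P)
  \<comment> \<open>Only nonempty words are known to have their value in the carrier, the unit being
    arbitrary here; the empty word must be ruled out of the support.\<close>
  have keys: "[] \<notin> Poly_Mapping.keys (poly_of P)"
  proof -
    have "Poly_Mapping.lookup (poly_of P) [] = 0"
      by (induction P) (simp_all add: poly_of_def lookup_add lookup_single when_def)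
    then show ?thesis by (simp add: in_keys_iff)
  qed
  have w: "word_val B v u \<in> carrier B" if "u \<noteq> []" for u
    using that v by (intro word_val_in) auto
  have "poly_val B v (poly_of (m # P)) =
      poly_val B v (Poly_Mapping.single (word_of (snd m)) (gaussian_val (fst m)) + poly_of P)"
    by (simp add: poly_of_def)
  also have "\<dots> = poly_val B v (Poly_Mapping.single (word_of (snd m)) (gaussian_val (fst m))) \<oplus>
      poly_val B v (poly_of P)"
  proof (rule poly_val_add)
    fix u assume "u \<in> Poly_Mapping.keys (Poly_Mapping.single (word_of (snd m)) (gaussian_val (fst m)))
      \<union> Poly_Mapping.keys (poly_of P)"
    then have "u \<noteq> []" using keys by (auto split: if_splits)
    then show "word_val B v u \<in> carrier B" by (rule w)
  qed
  finally show ?case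
    using Cons by (simp add: poly_val_single w)
qed

lemma rational_point_code:
  assumes "\<And>j. v j \<in> carrier B"
  shows "rational_point B v n = code_val B v (dec n)"
  by (simp add: rational_point_def poly_decode_eq poly_val_poly_of assms)

lemma word_val_append:
  assumes v: "\<And>j. v j \<in> carrier B" and "u \<noteq> []" "w \<noteq> []"
  shows "word_val B v (u @ w) = word_val B v u \<otimes> word_val B v w"
  using assms(2)
proof (induction u rule: induct_list012)
  case (2 l) then show ?case using \<open>w \<noteq> []\<close> by (cases w) auto
next
  case (3 l l' ls)
  have "letter_val B v l \<in> carrier B" "word_val B v (l' # ls) \<in> carrier B" "word_val B v w \<in> carrier B"
    using \<open>w \<noteq> []\<close> by (auto intro!: letter_val_in word_val_in v simp del: letter_val.simps)
  then show ?case using 3(2) by (simp add: mult_assoc)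
qed simp

lemma word_val_star:
  assumes v: "\<And>j. v j \<in> carrier B" and "u \<noteq> []"
  shows "word_val B v (rev (map (apsnd Not) u)) = star B (word_val B v u)"
proof -
  have letter: "letter_val B v (apsnd Not l) = star B (letter_val B v l)" for l
    using v by (cases l) (auto simp: star_star)
  show ?thesis
    using assms(2)
  proof (induction u rule: induct_list012)
    case (3 l l' ls)
    have "letter_val B v l \<in> carrier B" "word_val B v (l' # ls) \<in> carrier B"
      by (auto intro!: letter_val_in word_val_in v simp del: letter_val.simps)
    moreover have "word_val B v (rev (map (apsnd Not) (l # l' # ls))) =
        word_val B v (rev (map (apsnd Not) (l' # ls))) \<otimes> word_val B v [apsnd Not l]"
      unfolding list.map rev.simps by (subst word_val_append) (auto intro: v)
    ultimately show ?case
      using 3(2) by (simp add: letter star_mult)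
  qed (simp_all add: letter)
qed

context
  fixes v :: "nat \<Rightarrow> 'a"
  assumes v: "\<And>j. v j \<in> carrier B"
begin

lemma word_of_in: "word_val B v (word_of u) \<in> carrier B"
  by (intro word_val_in) (auto simp: v)

lemmas code_in = code_val_in[of v, OF v] word_of_in

lemma code_val_append: "code_val B v (P @ Q) = code_val B v P \<oplus> code_val B v Q"
  by (induction P) (auto simp: code_in a_assoc)

lemma code_val_smult: "code_val B v (code_smult c P) = gaussian_val c \<odot> code_val B v P"
  by (induction P) (auto simp: code_smult_def code_in smult_add_right smult_smult)

lemma code_val_star: "code_val B v (code_star P) = star B (code_val B v P)"
  by (induction P)
     (auto simp: code_star_def code_in star_add star_smult word_of_star word_val_star v)

lemma code_val_mult: "code_val B v (code_mult P Q) = code_val B v P \<otimes> code_val B v Q"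
proof (induction P)
  case (Cons m P)
  have row: "code_val B v (map (\<lambda>n. (gaussian_mult (fst m) (fst n), word_append (snd m) (snd n))) Q) =
      (gaussian_val (fst m) \<odot> word_val B v (word_of (snd m))) \<otimes> code_val B v Q"
    by (induction Q)
       (auto simp: code_in mult_r_distr word_of_append word_val_append v mult_smult_l mult_smult_r
         smult_smult mult_closed mult.commute)
  then show ?case
    using Cons by (simp add: code_mult_def code_val_append row code_in mult_l_distr)
qed (simp add: code_mult_def code_in)

lemma code_val_letter_subst:
  "code_val B v (letter_subst \<sigma> n) = letter_val B (\<lambda>j. code_val B v (\<sigma> j)) (letter_decode n)"
  by (simp add: letter_subst_def letter_decode_def code_val_star)

lemma code_val_word_subst:
  "code_val B v (word_subst \<sigma> u) = word_val B (\<lambda>j. code_val B v (\<sigma> j)) (word_of u)"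
proof -
  let ?w = "\<lambda>j. code_val B v (\<sigma> j)"
  \<comment> \<open>Generalised over the word \<open>w\<close> accumulated so far, which the
    induction extends by one letter on the right.\<close>
  have "code_val B v (fold (\<lambda>l P. code_mult P (letter_subst \<sigma> l)) ls P) =
      word_val B ?w (w @ map letter_decode ls)"
    if "code_val B v P = word_val B ?w w" "w \<noteq> []" for w P ls
    using that
  proof (induction ls arbitrary: P w)
    case (Cons l ls)
    have "code_val B v (code_mult P (letter_subst \<sigma> l)) = word_val B ?w (w @ [letter_decode l])"
      using Cons(2,3) by (simp add: code_val_mult code_val_letter_subst word_val_append code_in)
    from Cons(1)[OF this] show ?case by simp
  qed simp
  from this[of "letter_subst \<sigma> (fst u)" "[letter_decode (fst u)]" "snd u"]
  show ?thesis
    by (simp add: word_subst_def word_of_def code_val_letter_subst)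
qed

text \<open>A rational point formed from rational points is again a rational point, with a code that
  is computed from the given ones.\<close>

lemma code_val_subst:
  "code_val B v (code_subst \<sigma> P) = code_val B (\<lambda>j. code_val B v (\<sigma> j)) P"
proof (induction P)
  case (Cons m P)
  then show ?case
    by (simp add: code_subst_def code_val_append code_val_smult code_val_word_subst)
qed (simp add: code_subst_def)

end

text \<open>Elements of the generated *-subalgebra need not be rational points, because of their
  complex scalars. By induction on its generation each is a limit of rational points; density of the
  subalgebra does the rest.\<close>

lemma dense_codes:
  assumes "presentation B s" "x \<in> carrier B"
  obtains P where "conv (\<lambda>i. code_val B s (P i)) x"
proof -
  have s: "s j \<in> carrier B" for j
    using assms(1) by (auto simp: presentation_def)
  have approx: "\<exists>P. conv (\<lambda>i. code_val B s (P i)) y" if "y \<in> star_subalgebra B (range s)" for y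
    using that
  proof induction
    case (base x)
    then obtain j where x: "x = s j" by auto
    \<comment> \<open>The coefficient is 1 with imaginary part 0, and the word is the single even
      letter \<open>2 * j\<close>, the variable without adjoint.\<close>
    define P :: poly_code where "P = [(((1, 0), (0, 0)), (2 * j, []))]"
    have "code_val B s P = 1 \<odot> s j \<oplus> \<zero>"
      by (simp add: P_def word_of_def letter_decode_def gaussian_val_def rat_val_def one_complex.code)
    then have "code_val B s P = x" using s by (simp add: x)
    then show ?case using conv_const[of x] s x by (intro exI[of _ "\<lambda>i. P"]) simp
  next
    case zero
    show ?case using conv_const[of \<zero>] by (intro exI[of _ "\<lambda>i. []"]) simp
  next
    case (add x y)
    then obtain P Q where "conv (\<lambda>i. code_val B s (P i)) x" "conv (\<lambda>i. code_val B s (Q i)) y" by blast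
    from conv_add[OF this] show ?case
      by (intro exI[of _ "\<lambda>i. P i @ Q i"]) (simp add: code_val_append s)
  next
    case (smult x c)
    then obtain P where P: "conv (\<lambda>i. code_val B s (P i)) x" by blast
    obtain d where "(\<lambda>i. gaussian_val (d i)) \<longlonglongrightarrow> c" using gaussian_rational_limit by blast
    from conv_smult[OF this P] show ?case
      by (intro exI[of _ "\<lambda>i. code_smult (d i) (P i)"]) (simp add: code_val_smult s)
  next
    case (mult x y)
    then obtain P Q where "conv (\<lambda>i. code_val B s (P i)) x" "conv (\<lambda>i. code_val B s (Q i)) y" by blast
    from conv_mult[OF this] show ?case
      by (intro exI[of _ "\<lambda>i. code_mult (P i) (Q i)"]) (simp add: code_val_mult s)
  next
    case (star x)
    then obtain P where "conv (\<lambda>i. code_val B s (P i)) x" by blast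
    from conv_star[OF this] show ?case
      by (intro exI[of _ "\<lambda>i. code_star (P i)"]) (simp add: code_val_star s)
  qed
  interpret M: Metric_space "carrier B" "cdist B" by (rule metric)
  \<comment> \<open>One share \<open>1 / real (Suc i)\<close> is spent on going from
    \<open>x\<close> to the subalgebra, the other on going from there to a rational point.\<close>
  have "\<exists>P. cnorm B (code_val B s P \<ominus> x) \<le> 2 / real (Suc i)" for i
  proof -
    have "x \<in> M.mtopology closure_of star_subalgebra B (range s)"
      using assms by (simp add: presentation_def)
    then obtain y where y: "y \<in> star_subalgebra B (range s)" "y \<in> M.mball x (1 / real (Suc i))"
      unfolding M.metric_closure_of by (auto simp del: of_nat_Suc dest!: spec[of _ "1 / real (Suc i)"])
    then have yc: "y \<in> carrier B" and d: "cnorm B (x \<ominus> y) < 1 / real (Suc i)"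
      by (auto simp: cdist_def)
    obtain P where P: "conv (\<lambda>i. code_val B s (P i)) y" using approx y by blast
    then have "(\<lambda>i. cnorm B (code_val B s (P i) \<ominus> y)) \<longlonglongrightarrow> 0" by (simp add: conv_def)
    then have "\<forall>\<^sub>F n in sequentially. cnorm B (code_val B s (P n) \<ominus> y) < 1 / real (Suc i)"
      by (rule order_tendstoD) simp
    then obtain n where n: "cnorm B (code_val B s (P n) \<ominus> y) < 1 / real (Suc i)"
      by (auto simp: eventually_sequentially)
    have "cnorm B (code_val B s (P n) \<ominus> x) \<le> cnorm B (code_val B s (P n) \<ominus> y) + cnorm B (y \<ominus> x)"
      using s yc assms by (intro norm_minus_triangle code_val_in) auto
    also have "\<dots> \<le> 2 / real (Suc i)"
      using n d minus_commute_norm[of y x] yc assms by (simp add: field_simps del: of_nat_Suc)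
    finally show ?thesis by blast
  qed
  then obtain P where P: "\<And>i. cnorm B (code_val B s (P i) \<ominus> x) \<le> 2 / real (Suc i)" by metis
  have "(\<lambda>i. 2 * (1 / real (Suc i))) \<longlonglongrightarrow> 2 * 0"
    using LIMSEQ_inverse_real_of_nat by (intro tendsto_mult tendsto_const) (simp add: inverse_eq_divide)
  then have "conv (\<lambda>i. code_val B s (P i)) x"
    using P s assms(2) by (intro convI[where e = "\<lambda>i. 2 / real (Suc i)"] code_val_in) simp_all
  then show thesis by (rule that)
qed

end

text \<open>The recursion step is \<open>1 - (1 - P) (1 - Q) = P + Q - P Q\<close>.\<close>

definition unit_code :: "poly_code \<Rightarrow> nat \<Rightarrow> poly_code" where
  "unit_code P M = rec_nat [] (\<lambda>_ Q. P @ Q @ code_smult ((- 1, 0), (0, 0)) (code_mult P Q)) M"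

lemma cmp_unit_code [cmp_intros]: "cmp f \<Longrightarrow> cmp (\<lambda>x. unit_code P (f x))"
  unfolding unit_code_def by (intro cmp_intros)

context cstar_algebra begin

text \<open>The defect \<open>1 - u\<close> of the approximation is multiplied by
  \<open>1 - p\<close> in each step and so at least halved in norm. It starts at the unit itself,
  since the empty code has value zero. The factor \<open>cnorm B \<one>\<close> stays unevaluated,
  as it is 0 in the zero algebra.\<close>

lemma unit_code_bound:
  assumes "Group.monoid B" and s: "\<And>j. s j \<in> carrier B"
    and P: "cnorm B (code_val B s P \<ominus> \<one>) \<le> 1 / 2"
  shows "cnorm B (code_val B s (unit_code P M) \<ominus> \<one>) \<le> cnorm B \<one> / 2 ^ M"
proof (induction M)
  interpret monoid B by fact
  case 0
  show ?case using norm_uminus[of \<one>] by (simp add: unit_code_def a_minus_def)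
next
  interpret monoid B by fact
  case (Suc M)
  define p u where "p = code_val B s P" and "u = code_val B s (unit_code P M)"
  have c: "p \<in> carrier B" "u \<in> carrier B" "\<one> \<in> carrier B"
    by (auto simp: p_def u_def code_val_in s)
  have "gaussian_val ((- 1, 0), 0, 0) = - 1"
    by (simp add: gaussian_val_def rat_val_def complex_eq_iff)
  then have "code_val B s (unit_code P (Suc M)) = p \<oplus> (u \<oplus> \<ominus> (p \<otimes> u))"
    using s c by (simp add: unit_code_def code_val_append code_val_smult code_val_mult smult_m1 mult_closed
        p_def u_def)
  moreover have "(p \<oplus> (u \<oplus> \<ominus> (p \<otimes> u))) \<ominus> \<one> = \<ominus> ((p \<ominus> \<one>) \<otimes> (u \<ominus> \<one>))"
  proof -
    have "(p \<ominus> \<one>) \<otimes> (u \<ominus> \<one>) = (p \<otimes> u \<ominus> u) \<ominus> (p \<ominus> \<one>)"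
      using c by (simp add: mult_minus_left mult_minus_right)
    then show ?thesis
      using c by (simp add: a_minus_def mult_closed minus_add minus_minus a_ac)
  qed
  ultimately have "cnorm B (code_val B s (unit_code P (Suc M)) \<ominus> \<one>) = cnorm B ((p \<ominus> \<one>) \<otimes> (u \<ominus> \<one>))"
    using c by (simp add: norm_uminus mult_closed)
  also have "\<dots> \<le> cnorm B (p \<ominus> \<one>) * cnorm B (u \<ominus> \<one>)"
    using c by (intro cnorm_mult) auto
  also have "\<dots> \<le> (1 / 2) * (cnorm B \<one> / 2 ^ M)"
    using P Suc c by (intro mult_mono) (auto simp: p_def u_def intro: norm_nonneg)
  finally show ?case by simp
qed

end

section \<open>Transport of structure\<close>

definition transport :: "('a \<Rightarrow> 'b) \<Rightarrow> 'a cstar \<Rightarrow> 'b cstar" where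
  "transport \<phi> B = (let \<psi> = inv_into (carrier B) \<phi> in
    \<lparr>carrier = \<phi> ` carrier B,
     mult = (\<lambda>x y. \<phi> (\<psi> x \<otimes>\<^bsub>B\<^esub> \<psi> y)),
     one = \<phi> \<one>\<^bsub>B\<^esub>,
     zero = \<phi> \<zero>\<^bsub>B\<^esub>,
     add = (\<lambda>x y. \<phi> (\<psi> x \<oplus>\<^bsub>B\<^esub> \<psi> y)),
     smult = (\<lambda>c x. \<phi> (c \<odot>\<^bsub>B\<^esub> \<psi> x)),
     star = (\<lambda>x. \<phi> (star B (\<psi> x))),
     cnorm = (\<lambda>x. cnorm B (\<psi> x))\<rparr>)"

locale transported = cstar_algebra B for B :: "'a cstar" (structure) +
  fixes \<phi> :: "'a \<Rightarrow> 'b"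
  assumes inj: "inj_on \<phi> (carrier B)"
begin

abbreviation "T \<equiv> transport \<phi> B"

lemma T_simps [simp]:
  "carrier T = \<phi> ` carrier B" "\<one>\<^bsub>T\<^esub> = \<phi> \<one>" "\<zero>\<^bsub>T\<^esub> = \<phi> \<zero>"
  "\<lbrakk>x \<in> carrier B; y \<in> carrier B\<rbrakk> \<Longrightarrow> \<phi> x \<otimes>\<^bsub>T\<^esub> \<phi> y = \<phi> (x \<otimes> y)"
  "\<lbrakk>x \<in> carrier B; y \<in> carrier B\<rbrakk> \<Longrightarrow> \<phi> x \<oplus>\<^bsub>T\<^esub> \<phi> y = \<phi> (x \<oplus> y)"
  "x \<in> carrier B \<Longrightarrow> c \<odot>\<^bsub>T\<^esub> \<phi> x = \<phi> (c \<odot> x)"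
  "x \<in> carrier B \<Longrightarrow> star T (\<phi> x) = \<phi> (star B x)"
  "x \<in> carrier B \<Longrightarrow> cnorm T (\<phi> x) = cnorm B x"
  using inj by (simp_all add: transport_def Let_def)

lemma \<phi>_eq_iff [simp]: "\<lbrakk>x \<in> carrier B; y \<in> carrier B\<rbrakk> \<Longrightarrow> \<phi> x = \<phi> y \<longleftrightarrow> x = y"
  using inj by (auto dest: inj_onD)

lemma abelian_group_T: "abelian_group T"
proof (rule abelian_groupI)
  show "\<exists>y\<in>carrier T. y \<oplus>\<^bsub>T\<^esub> x = \<zero>\<^bsub>T\<^esub>" if "x \<in> carrier T" for x
  proof -
    from that obtain a where a: "a \<in> carrier B" "x = \<phi> a" by auto
    then show ?thesis by (intro bexI[of _ "\<phi> (\<ominus> a)"]) (simp_all add: l_neg)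
  qed
qed (auto simp: a_ac)

lemma module_T: "Module.module complex_ring T"
  by (rule moduleI[OF R.cring_axioms abelian_group_T])
     (auto simp: smult_add_left smult_add_right smult_smult)

lemma minus_T: "\<lbrakk>x \<in> carrier B; y \<in> carrier B\<rbrakk> \<Longrightarrow> \<phi> x \<ominus>\<^bsub>T\<^esub> \<phi> y = \<phi> (x \<ominus> y)"
  using abelian_group.minus_equality[OF abelian_group_T, of "\<phi> (\<ominus> y)" "\<phi> y"]
  by (simp add: a_minus_def l_neg)

lemma cdist_T: "\<lbrakk>x \<in> carrier B; y \<in> carrier B\<rbrakk> \<Longrightarrow> cdist T (\<phi> x) (\<phi> y) = cdist B x y"
  by (simp add: cdist_def minus_T)

lemma normed_group_T: "normed_group T"
proof -
  interpret T: abelian_group T by (rule abelian_group_T)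
  show ?thesis
  proof unfold_locales
    fix x assume "x \<in> carrier T"
    then obtain a where a: "a \<in> carrier B" "x = \<phi> a" by auto
    show "0 \<le> cnorm T x" "cnorm T x = 0 \<longleftrightarrow> x = \<zero>\<^bsub>T\<^esub>"
      using a by (auto simp: norm_nonneg norm_eq_0_iff)
    show "cnorm T (\<ominus>\<^bsub>T\<^esub> x) = cnorm T x"
      using T.minus_equality[of "\<phi> (\<ominus> a)" x] a by (simp add: l_neg norm_uminus)
  qed (auto simp: norm_triangle)
qed

lemma complete_T: "Metric_space.mcomplete (carrier T) (cdist T)"
proof -
  interpret M: Metric_space "carrier B" "cdist B" by (rule metric)
  interpret MT: Metric_space "carrier T" "cdist T" by (rule normed_group.metric[OF normed_group_T])
  show ?thesis
    unfolding MT.mcomplete_def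
  proof (intro allI impI)
    fix \<sigma> assume \<sigma>: "MT.MCauchy \<sigma>"
    then have "\<sigma> n \<in> \<phi> ` carrier B" for n
      unfolding MT.MCauchy_def by auto
    then have "\<exists>a. a \<in> carrier B \<and> \<sigma> n = \<phi> a" for n
      by blast
    \<comment> \<open>The Cauchy sequence is lifted along the isometry; the limit of the lift is
      then mapped back.\<close>
    then obtain \<tau> where \<tau>: "\<And>n. \<tau> n \<in> carrier B" "\<And>n. \<sigma> n = \<phi> (\<tau> n)" by metis
    have "M.MCauchy \<tau>"
      using \<sigma> \<tau> unfolding MT.MCauchy_def M.MCauchy_def by (auto simp: cdist_T)
    then obtain l where "limitin M.mtopology \<tau> l sequentially"
      using complete by (auto simp: M.mcomplete_def)
    then have "limitin MT.mtopology \<sigma> (\<phi> l) sequentially"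
      using \<tau> unfolding M.limitin_metric_dist_null MT.limitin_metric_dist_null by (simp add: cdist_T)
    then show "\<exists>x. limitin MT.mtopology \<sigma> x sequentially" by blast
  qed
qed

lemma cstar_algebra_T: "cstar_algebra T"
proof (intro cstar_algebra.intro cstar_algebra_axioms.intro)
  show "Module.module complex_ring T" by (rule module_T)
  show "Metric_space.mcomplete (carrier T) (cdist T)" by (rule complete_T)
qed (auto simp: mult_closed mult_assoc mult_l_distr mult_r_distr mult_smult_l mult_smult_r star_closed
    star_star star_add star_smult star_mult cnorm_nonneg cnorm_eq_0_iff cnorm_triangle cnorm_smult
    cnorm_mult cstar_identity)

lemma monoid_T: "Group.monoid B \<Longrightarrow> Group.monoid T"
  unfolding Group.monoid_def by (auto simp: mult_assoc mult_closed)

lemma poly_val_T: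
  assumes "\<And>j. j \<in> poly_vars p \<Longrightarrow> v j \<in> carrier B \<and> w j = \<phi> (v j)" "Group.monoid B"
  shows "poly_val T w p = \<phi> (poly_val B v p)" "poly_val B v p \<in> carrier B"
proof -
  interpret T: cstar_algebra T by (rule cstar_algebra_T)
  interpret monoid B by fact
  show "poly_val T w p = \<phi> (poly_val B v p)" "poly_val B v p \<in> carrier B"
    by (rule poly_val_hom[of B T \<phi> p v w];
        (intro star_structure_axioms T.star_structure_axioms)?; use assms(1) in simp)+
qed

end

text \<open>The transported copy is isometrically *-isomorphic to \<open>A\<close>, so the defect of
  the image tuple is the same; the solution found in the copy is pulled back.\<close>

lemma weak_stability_transfer:
  fixes A :: "'a cstar" and \<phi> :: "'a \<Rightarrow> nat \<Rightarrow> nat"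
  assumes "cstar_algebra A" "Group.monoid A" "inj_on \<phi> (carrier A)" "relation_set R"
    and g: "weak_stability_modulus R g"
    and w: "w \<in> {..<nvars R} \<rightarrow>\<^sub>E carrier A" "defect A R w < 1 / 2 ^ g k"
  obtains z where "z \<in> {..<nvars R} \<rightarrow>\<^sub>E carrier A" "satisfies A R z"
    "\<And>j. j < nvars R \<Longrightarrow> cnorm A (w j \<ominus>\<^bsub>A\<^esub> z j) < 1 / 2 ^ k"
proof -
  interpret A: cstar_algebra A by fact
  interpret transported A \<phi> by unfold_locales fact
  have vars: "j < nvars R" if "p \<in> set (polys R)" "j \<in> poly_vars p" for p j
    using \<open>relation_set R\<close> that by (auto simp: relation_set_def)
  define n where "n = nvars R"
  have "n \<ge> 1" using \<open>relation_set R\<close> by (simp add: relation_set_def n_def)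
  \<comment> \<open>Tuples are extensional functions, hence the restriction to
    \<open>{..<n}\<close>.\<close>
  define w' where "w' = (\<lambda>j\<in>{..<n}. \<phi> (w j))"
  have wc: "w j \<in> carrier A" if "j < n" for j using w that by (auto simp: n_def)
  have w': "w' \<in> {..<n} \<rightarrow>\<^sub>E carrier T" using wc by (auto simp: w'_def)
  have "cnorm T (poly_val T w' p) = cnorm A (poly_val A w p)" if "p \<in> set (polys R)" for p
    using poly_val_T[of p w w'] vars[OF that] wc \<open>Group.monoid A\<close> by (simp add: w'_def n_def)
  moreover have "cnorm T (w' j) = cnorm A (w j)" if "j < n" for j
    using that wc by (simp add: w'_def)
  ultimately have "defect T R w' = defect A R w"
    unfolding defect_def n_def[symmetric] by simp
  then have "defect T R w' < 1 / 2 ^ g k" using w by simp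
  moreover have "interpretable T R" using monoid_T \<open>Group.monoid A\<close> by (simp add: interpretable_def)
  ultimately obtain z' where z': "z' \<in> {..<n} \<rightarrow>\<^sub>E carrier T"
    "Max ((\<lambda>j. cnorm T (w' j \<ominus>\<^bsub>T\<^esub> z' j)) ` {..<n}) < 1 / 2 ^ k" "satisfies T R z'"
    using g cstar_algebra_T w' unfolding weak_stability_modulus_def n_def by blast
  define z where "z = (\<lambda>j\<in>{..<n}. inv_into (carrier A) \<phi> (z' j))"
  have z: "z j \<in> carrier A" "z' j = \<phi> (z j)" if "j < n" for j
  proof -
    have "z' j \<in> \<phi> ` carrier A" using z'(1) that by (auto simp: PiE_iff)
    then show "z j \<in> carrier A" "z' j = \<phi> (z j)"
      using that by (simp_all add: z_def inv_into_into f_inv_into_f)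
  qed
  show thesis
  proof
    show "z \<in> {..<nvars R} \<rightarrow>\<^sub>E carrier A"
      by (rule PiE_I) (use z(1) in \<open>auto simp: n_def z_def\<close>)
    show "cnorm A (w j \<ominus>\<^bsub>A\<^esub> z j) < 1 / 2 ^ k" if "j < nvars R" for j
    proof -
      \<comment> \<open>\<open>n \<ge> 1\<close> makes this a maximum over a nonempty set, which
        bounds every coordinate.\<close>
      have "cnorm T (w' j \<ominus>\<^bsub>T\<^esub> z' j) < 1 / 2 ^ k"
        using z'(2) that \<open>n \<ge> 1\<close> by (subst (asm) Max_less_iff) (auto simp: n_def lessThan_empty_iff)
      then show ?thesis
        using that z wc by (simp add: n_def w'_def minus_T)
    qed
    show "satisfies A R z"
      unfolding satisfies_def
    proof (intro conjI ballI allI impI)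
      fix p assume p: "p \<in> set (polys R)"
      then have "poly_val T z' p = \<zero>\<^bsub>T\<^esub>" using z'(3) by (simp add: satisfies_def)
      moreover have "poly_val T z' p = \<phi> (poly_val A z p)" "poly_val A z p \<in> carrier A"
        using poly_val_T[of p z z'] vars[OF p] z \<open>Group.monoid A\<close> by (simp_all add: n_def)
      ultimately show "poly_val A z p = \<zero>\<^bsub>A\<^esub>" by simp
    next
      fix j assume j: "j < nvars R"
      then have "cnorm T (z' j) \<le> real (bounds R j)"
        using z'(3) by (simp add: satisfies_def)
      then show "cnorm A (z j) \<le> real (bounds R j)"
        using z[of j] j by (simp add: n_def)
    qed
  qed
qed

lemma half_power_limit: "(\<lambda>k. c / 2 ^ k :: real) \<longlonglongrightarrow> 0"
proof -
  have "(\<lambda>k. c * (1 / 2) ^ k) \<longlonglongrightarrow> c * 0"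
    by (intro tendsto_mult tendsto_const LIMSEQ_power_zero) simp
  then show ?thesis by (simp add: power_one_over)
qed

text \<open>An element is recorded by giving, for each \<open>k\<close>, the least code of a
  rational point closer to it than \<open>1 / 2 ^ k\<close>. These points converge to the element,
  so the record determines it.\<close>

lemma (in cstar_algebra) separable_inj:
  assumes "presentation B s"
  obtains \<phi> :: "'a \<Rightarrow> nat \<Rightarrow> nat" where "inj_on \<phi> (carrier B)"
proof -
  have s: "s j \<in> carrier B" for j
    using assms by (auto simp: presentation_def)
  let ?q = "\<lambda>n. code_val B s (dec n)"
  define \<phi> where "\<phi> x k = (LEAST n. cnorm B (?q n \<ominus> x) < 1 / 2 ^ k)" for x and k :: nat
  have near: "cnorm B (?q (\<phi> x k) \<ominus> x) < 1 / 2 ^ k" if "x \<in> carrier B" for x k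
    unfolding \<phi>_def
  proof (rule LeastI_ex)
    obtain P where "conv (\<lambda>i. code_val B s (P i)) x"
      using dense_codes[OF assms \<open>x \<in> carrier B\<close>] .
    then have "(\<lambda>i. cnorm B (code_val B s (P i) \<ominus> x)) \<longlonglongrightarrow> 0" by (simp add: conv_def)
    then have "\<forall>\<^sub>F i in sequentially. cnorm B (code_val B s (P i) \<ominus> x) < 1 / 2 ^ k"
      by (rule order_tendstoD) simp
    then obtain i where "cnorm B (code_val B s (P i) \<ominus> x) < 1 / 2 ^ k"
      by (auto simp: eventually_sequentially)
    then show "\<exists>n. cnorm B (?q n \<ominus> x) < 1 / 2 ^ k"
      by (intro exI[of _ "enc (P i)"]) simp
  qed
  have "inj_on \<phi> (carrier B)"
  proof (rule inj_onI)
    fix x y assume xy: "x \<in> carrier B" "y \<in> carrier B" "\<phi> x = \<phi> y"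
    have q: "conv (\<lambda>k. ?q (\<phi> x k)) x" if "x \<in> carrier B" for x
    proof (rule convI)
      have "(\<lambda>k. (1 / 2 :: real) ^ k) \<longlonglongrightarrow> 0" by (rule LIMSEQ_power_zero) simp
      then show "(\<lambda>k. 1 / 2 ^ k :: real) \<longlonglongrightarrow> 0" by (simp add: power_one_over)
    qed (use near that s in \<open>auto intro!: code_val_in less_imp_le\<close>)
    from q[OF xy(1)] q[OF xy(2)] xy(3) show "x = y" by (auto intro: conv_unique)
  qed
  then show thesis by (rule that)
qed

section \<open>Powers\<close>

text \<open>With \<open>N = 0\<close> the norm would be the maximum of an empty set.\<close>

locale cstar_power = cstar_algebra B for B :: "'a cstar" (structure) +
  fixes N :: nat
  assumes N_pos: "1 \<le> N"
begin

abbreviation "P \<equiv> power_algebra B N"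

lemma P_simps [simp]:
  "carrier P = {..<N} \<rightarrow>\<^sub>E carrier B" "\<zero>\<^bsub>P\<^esub> = (\<lambda>j\<in>{..<N}. \<zero>)"
  "x \<otimes>\<^bsub>P\<^esub> y = (\<lambda>j\<in>{..<N}. x j \<otimes> y j)" "x \<oplus>\<^bsub>P\<^esub> y = (\<lambda>j\<in>{..<N}. x j \<oplus> y j)"
  "c \<odot>\<^bsub>P\<^esub> x = (\<lambda>j\<in>{..<N}. c \<odot> x j)" "star P x = (\<lambda>j\<in>{..<N}. star B (x j))"
  by (simp_all add: power_algebra_def)

lemma cnorm_P: "cnorm P x = Max ((\<lambda>j. cnorm B (x j)) ` {..<N})"
  by (simp add: power_algebra_def)

lemma nonempty: "{..<N} \<noteq> {}"
  using N_pos by (simp add: lessThan_empty_iff)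

lemma in_P: "\<lbrakk>x \<in> {..<N} \<rightarrow>\<^sub>E carrier B; j < N\<rbrakk> \<Longrightarrow> x j \<in> carrier B"
  by (auto simp: PiE_iff)

lemma eq_P:
  "\<lbrakk>x \<in> {..<N} \<rightarrow>\<^sub>E carrier B; y \<in> {..<N} \<rightarrow>\<^sub>E carrier B; \<And>j. j < N \<Longrightarrow> x j = y j\<rbrakk> \<Longrightarrow> x = y"
  by (rule PiE_ext) auto

lemma abelian_group_P: "abelian_group P"
proof (rule abelian_groupI)
  show "\<exists>y\<in>carrier P. y \<oplus>\<^bsub>P\<^esub> x = \<zero>\<^bsub>P\<^esub>" if "x \<in> carrier P" for x
    using that by (intro bexI[of _ "\<lambda>j\<in>{..<N}. \<ominus> x j"]) (auto simp: fun_eq_iff l_neg in_P)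
  show "x \<oplus>\<^bsub>P\<^esub> y \<oplus>\<^bsub>P\<^esub> z = x \<oplus>\<^bsub>P\<^esub> (y \<oplus>\<^bsub>P\<^esub> z)"
    if "x \<in> carrier P" "y \<in> carrier P" "z \<in> carrier P" for x y z
    using that by (auto simp: fun_eq_iff a_assoc in_P)
  show "x \<oplus>\<^bsub>P\<^esub> y = y \<oplus>\<^bsub>P\<^esub> x" if "x \<in> carrier P" "y \<in> carrier P" for x y
    using that by (auto simp: fun_eq_iff a_comm in_P)
  show "\<zero>\<^bsub>P\<^esub> \<oplus>\<^bsub>P\<^esub> x = x" if "x \<in> carrier P" for x
    using that by (intro eq_P) (auto simp: in_P)
qed (auto simp: in_P)

lemma uminus_P: "x \<in> carrier P \<Longrightarrow> \<ominus>\<^bsub>P\<^esub> x = (\<lambda>j\<in>{..<N}. \<ominus> x j)"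
  by (rule abelian_group.minus_equality[OF abelian_group_P]) (auto simp: fun_eq_iff l_neg in_P)

lemma minus_P: "\<lbrakk>x \<in> carrier P; y \<in> carrier P; j < N\<rbrakk> \<Longrightarrow> (x \<ominus>\<^bsub>P\<^esub> y) j = x j \<ominus> y j"
  unfolding a_minus_def by (subst uminus_P) auto

lemma star_structure_P: "star_structure P"
proof -
  interpret abelian_group P by (rule abelian_group_P)
  show ?thesis
    by unfold_locales (auto simp: in_P mult_closed star_closed)
qed

lemma cnorm_P_less_iff: "cnorm P x < r \<longleftrightarrow> (\<forall>j<N. cnorm B (x j) < r)"
  using nonempty by (auto simp: cnorm_P Max_less_iff)

lemma cnorm_P_le_iff: "cnorm P x \<le> r \<longleftrightarrow> (\<forall>j<N. cnorm B (x j) \<le> r)"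
  using nonempty by (auto simp: cnorm_P Max_le_iff)

lemma cnorm_P_ge: "j < N \<Longrightarrow> cnorm B (x j) \<le> cnorm P x"
  using cnorm_P_le_iff[of x "cnorm P x"] by auto

lemma normed_group_P: "normed_group P"
proof -
  interpret PG: abelian_group P by (rule abelian_group_P)
  show ?thesis
  proof unfold_locales
    fix x assume x: "x \<in> carrier P"
    show nonneg: "0 \<le> cnorm P x"
      using cnorm_P_ge[of 0 x] norm_nonneg[of "x 0"] x N_pos in_P[of x 0] by simp
    show "cnorm P x = 0 \<longleftrightarrow> x = \<zero>\<^bsub>P\<^esub>"
    proof
      assume 0: "cnorm P x = 0"
      have "x j = \<zero>" if "j < N" for j
        using cnorm_P_ge[OF that, of x] norm_nonneg[of "x j"] norm_eq_0_iff[of "x j"] 0 x that in_P[of x j]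
        by simp
      then show "x = \<zero>\<^bsub>P\<^esub>" using x by (intro eq_P) auto
    next
      assume "x = \<zero>\<^bsub>P\<^esub>"
      then have "cnorm P x \<le> 0" unfolding cnorm_P_le_iff by simp
      then show "cnorm P x = 0" using nonneg by simp
    qed
    have "cnorm B ((\<ominus>\<^bsub>P\<^esub> x) j) = cnorm B (x j)" if "j < N" for j
      using x that by (subst uminus_P) (auto simp: in_P norm_uminus)
    then show "cnorm P (\<ominus>\<^bsub>P\<^esub> x) = cnorm P x" by (simp add: cnorm_P)
  next
    fix x y assume xy: "x \<in> carrier P" "y \<in> carrier P"
    show "cnorm P (x \<oplus>\<^bsub>P\<^esub> y) \<le> cnorm P x + cnorm P y"
      unfolding cnorm_P_le_iff
    proof (intro allI impI)
      fix j assume j: "j < N"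
      have "cnorm B ((x \<oplus>\<^bsub>P\<^esub> y) j) \<le> cnorm B (x j) + cnorm B (y j)"
        using xy j by (auto simp: in_P norm_triangle)
      also have "\<dots> \<le> cnorm P x + cnorm P y"
        by (intro add_mono cnorm_P_ge j)
      finally show "cnorm B ((x \<oplus>\<^bsub>P\<^esub> y) j) \<le> cnorm P x + cnorm P y" .
    qed
  qed
qed

lemma cdist_P_less_iff:
  assumes "x \<in> carrier P" "y \<in> carrier P"
  shows "cdist P x y < r \<longleftrightarrow> (\<forall>j<N. cnorm B (x j \<ominus> y j) < r)"
proof -
  have "cdist P x y = cnorm P (x \<ominus>\<^bsub>P\<^esub> y)" using assms by (simp add: cdist_def)
  then show ?thesis
    using minus_P[OF assms] by (auto simp: cnorm_P_less_iff)
qed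

lemma conv_coord:
  assumes "normed_group.conv P x l" "j < N" shows "conv (\<lambda>i. x i j) (l j)"
proof -
  interpret PN: normed_group P by (rule normed_group_P)
  note c = PN.conv_closed[OF assms(1)]
  show ?thesis
  proof (rule convI)
    show "x i j \<in> carrier B" "l j \<in> carrier B" for i using c assms(2) by (auto simp: in_P)
    show "cnorm B (x i j \<ominus> l j) \<le> cnorm P (x i \<ominus>\<^bsub>P\<^esub> l)" for i
      using cnorm_P_ge[OF assms(2), of "x i \<ominus>\<^bsub>P\<^esub> l"] minus_P[OF c(1,2) assms(2)] by simp
    show "(\<lambda>i. cnorm P (x i \<ominus>\<^bsub>P\<^esub> l)) \<longlonglongrightarrow> 0" using assms(1) by (simp only: PN.conv_def)
  qed
qed

text \<open>The projection to a coordinate is a *-homomorphism, which reduces evaluation in the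
  power to evaluation in \<open>B\<close>.\<close>

lemma poly_val_coord:
  assumes "\<And>m. t m \<in> carrier P" "Poly_Mapping.lookup p [] = 0" "j < N"
  shows "poly_val P t p j = poly_val B (\<lambda>m. t m j) p" "poly_val P t p \<in> carrier P"
proof -
  have "poly_val B (\<lambda>m. t m j) p = (\<lambda>x. x j) (poly_val P t p)" "poly_val P t p \<in> carrier P"
    by (rule poly_val_hom[of P B "\<lambda>x. x j" p t];
        (intro star_structure_axioms star_structure_P)?; use assms in \<open>simp add: in_P\<close>)+
  then show "poly_val P t p j = poly_val B (\<lambda>m. t m j) p" "poly_val P t p \<in> carrier P" by simp_all
qed

text \<open>Equations and norm bounds both survive limits: the former by continuity of
  *-polynomials, the latter because they are not strict.\<close>

lemma closedin_solutions:
  assumes "relation_set R" "nvars R = N" "Group.monoid B"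
  shows "closedin (Metric_space.mtopology (carrier P) (cdist P)) (solutions B R)"
proof -
  interpret PN: normed_group P by (rule normed_group_P)
  interpret M: Metric_space "carrier P" "cdist P" by (rule PN.metric)
  interpret monoid B by fact
  show ?thesis
    unfolding M.metric_closedin_iff_sequentially_closed
  proof (intro conjI allI impI)
    show "solutions B R \<subseteq> carrier P" using assms by (auto simp: solutions_def)
    fix \<sigma> l assume "range \<sigma> \<subseteq> solutions B R \<and> limitin M.mtopology \<sigma> l sequentially"
    then have \<sigma>: "range \<sigma> \<subseteq> solutions B R" and lim: "limitin M.mtopology \<sigma> l sequentially" by auto
    then have "range \<sigma> \<subseteq> carrier P" using assms by (auto simp: solutions_def)
    then have l: "PN.conv \<sigma> l" using lim by (simp only: PN.limitin_iff_conv)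
    have c: "conv (\<lambda>i. \<sigma> i j) (l j)" if "j < N" for j using conv_coord[OF l that] .
    have sat: "satisfies B R (\<sigma> i)" for i using \<sigma> by (auto simp: solutions_def)
    have "satisfies B R l"
      unfolding satisfies_def
    proof (intro conjI ballI allI impI)
      fix p assume p: "p \<in> set (polys R)"
      then have "conv (\<lambda>i. poly_val B (\<sigma> i) p) (poly_val B l p)"
        using assms by (intro conv_poly_val c) (auto simp: relation_set_def)
      moreover have "(\<lambda>i. poly_val B (\<sigma> i) p) = (\<lambda>i. \<zero>)"
        using sat p by (auto simp: satisfies_def)
      ultimately show "poly_val B l p = \<zero>"
        using conv_const[of \<zero>] conv_unique by auto
    next
      fix j assume j: "j < nvars R"
      then have "(\<lambda>i. cnorm B (\<sigma> i j)) \<longlonglongrightarrow> cnorm B (l j)"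
        using c assms by (intro conv_norm) auto
      then show "cnorm B (l j) \<le> real (bounds R j)"
        by (rule LIMSEQ_le_const2) (use sat j in \<open>auto simp: satisfies_def\<close>)
    qed
    then show "l \<in> solutions B R"
      using PN.conv_closed(2)[OF l] assms by (simp add: solutions_def)
  qed
qed

end

section \<open>The semidecision procedure\<close>

text \<open>The single pattern behind all choices of search parameters: finitely many strict
  inequalities that hold in the limit hold at some common stage.\<close>

lemma eventually_ball_less:
  fixes x :: "'c \<Rightarrow> nat \<Rightarrow> real"
  assumes "finite J" "\<And>j. j \<in> J \<Longrightarrow> x j \<longlonglongrightarrow> a j" "\<And>j. j \<in> J \<Longrightarrow> a j < b j"
  shows "\<forall>\<^sub>F i in sequentially. \<forall>j\<in>J. x j i < b j"
  using assms by (intro eventually_ball_finite ballI order_tendstoD(2)) auto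

text \<open>The value of a code divides by the successor of its second component.\<close>

definition dyadic :: "nat \<Rightarrow> nat \<Rightarrow> rat_code" where
  "dyadic K k = (int K, 2 ^ k - 1)"

lemma rat_val_dyadic: "real_of_rat (rat_val (dyadic K k)) = real K / 2 ^ k"
  by (simp add: dyadic_def rat_val_def of_rat_divide of_rat_power)

lemma cmp_dyadic [cmp_intros]: "cmp f \<Longrightarrow> cmp (\<lambda>x. dyadic K (f x))"
  unfolding dyadic_def by (intro cmp_intros)

locale ce_setting = cstar_power A N for A :: "'a cstar" (structure) and N :: nat +
  fixes s :: "nat \<Rightarrow> 'a" and R :: star_relations and e :: "nat \<Rightarrow> nat \<Rightarrow> nat"
    and f :: "nat \<Rightarrow> nat \<Rightarrow> nat" and g :: "nat \<Rightarrow> nat"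
  assumes monoid: "Group.monoid A"
    and presentation: "presentation A s"
    and computable_f: "computable2 f"
    and f_decseq: "decseq (\<lambda>k. rat_decode (f n k))"
    and f_limit: "(\<lambda>k. real_of_rat (rat_decode (f n k))) \<longlonglongrightarrow> cnorm A (rational_point A s n)"
    and relation_set: "relation_set R" and nvars: "nvars R = N"
    and computable_g: "computable g" and modulus: "weak_stability_modulus R g"
    and tuple_enum: "computable_tuple_enum N e"
begin

lemma s: "s j \<in> carrier A"
  using presentation by (auto simp: presentation_def)

lemma one: "\<one> \<in> carrier A"
  using monoid by (rule monoid.one_closed)

abbreviation val :: "poly_code \<Rightarrow> 'a" where "val \<equiv> code_val A s"

lemma val_in [simp]: "val Q \<in> carrier A"
  by (rule code_val_in[OF s])

text \<open>The approximations decrease to the norm. Being upper bounds at every stage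
  \<open>l\<close> makes the test sound; converging makes it succeed eventually.\<close>

definition upper :: "poly_code \<Rightarrow> nat \<Rightarrow> rat_code" where
  "upper Q l = dec (f (enc Q) l)"

lemma cmp_upper [cmp_intros]: "cmp F \<Longrightarrow> cmp G \<Longrightarrow> cmp (\<lambda>x. upper (F x) (G x))"
  unfolding upper_def by (intro cmp_intros cmp_computable2[OF computable_f])

lemma cnorm_le_upper: "cnorm A (val Q) \<le> real_of_rat (rat_val (upper Q l))"
proof -
  have "decseq (\<lambda>k. real_of_rat (rat_decode (f (enc Q) k)))"
    using f_decseq[of "enc Q"] by (simp add: decseq_def of_rat_less_eq)
  from decseq_ge[OF this f_limit] show ?thesis
    by (simp add: upper_def rat_decode_eq rational_point_code s)
qed

lemma upper_limit: "(\<lambda>l. real_of_rat (rat_val (upper Q l))) \<longlonglongrightarrow> cnorm A (val Q)"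
  using f_limit[of "enc Q"] by (simp add: upper_def rat_decode_eq rational_point_code s)

text \<open>Exists by density and is picked once and for all; it enters the algorithm as a
  constant.\<close>

definition unit_seed :: poly_code where
  "unit_seed = (SOME Q. cnorm A (val Q \<ominus> \<one>) \<le> 1 / 2)"

abbreviation unit_approx :: "nat \<Rightarrow> poly_code" where
  "unit_approx \<equiv> unit_code unit_seed"

lemma unit_approx_bound: "cnorm A (val (unit_approx M) \<ominus> \<one>) \<le> cnorm A \<one> / 2 ^ M"
proof (rule unit_code_bound[OF monoid s])
  obtain P where "conv (\<lambda>i. val (P i)) \<one>" using dense_codes[OF presentation one] .
  then have "(\<lambda>i. cnorm A (val (P i) \<ominus> \<one>)) \<longlonglongrightarrow> 0" by (simp add: conv_def)
  then have "\<forall>\<^sub>F i in sequentially. cnorm A (val (P i) \<ominus> \<one>) < 1 / 2"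
    by (rule order_tendstoD) simp
  then obtain i where "cnorm A (val (P i) \<ominus> \<one>) < 1 / 2" by (auto simp: eventually_sequentially)
  then have "\<exists>Q. cnorm A (val Q \<ominus> \<one>) \<le> 1 / 2"
    using less_imp_le by blast
  then show "cnorm A (val unit_seed \<ominus> \<one>) \<le> 1 / 2"
    unfolding unit_seed_def by (rule someI_ex)
qed

definition const_code :: "star_poly \<Rightarrow> gaussian_code" where
  "const_code p = (SOME c. gaussian_val c = Poly_Mapping.lookup p [])"

text \<open>The constant term is split off because codes cannot express it; it is multiplied by an
  approximate unit afterwards.\<close>

definition rest_code :: "star_poly \<Rightarrow> poly_code" where
  "rest_code p = (SOME Q. poly_of Q = p - Poly_Mapping.single [] (Poly_Mapping.lookup p []))"

lemma const_code:
  assumes "rational_poly p" shows "gaussian_val (const_code p) = Poly_Mapping.lookup p []"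
  unfolding const_code_def
proof (rule someI_ex)
  have "Poly_Mapping.lookup p [] \<in> range gaussian_decode"
    using assms unfolding range_gaussian_decode rational_poly_def by auto
  then obtain n where "Poly_Mapping.lookup p [] = gaussian_decode n" ..
  then have "gaussian_val (dec n) = Poly_Mapping.lookup p []"
    by (simp add: gaussian_decode_eq)
  then show "\<exists>c. gaussian_val c = Poly_Mapping.lookup p []" ..
qed

lemma rest_code:
  assumes "rational_poly p"
  shows "poly_of (rest_code p) = p - Poly_Mapping.single [] (Poly_Mapping.lookup p [])"
  unfolding rest_code_def
proof (rule someI_ex)
  have "p - Poly_Mapping.single [] (Poly_Mapping.lookup p []) \<in> range poly_decode"
    unfolding range_poly_decode using assms
    by (auto simp: rational_poly_def lookup_minus lookup_single when_def gaussian_rationals_def)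
  then show "\<exists>Q. poly_of Q = p - Poly_Mapping.single [] (Poly_Mapping.lookup p [])"
    by (auto simp: poly_decode_eq)
qed

lemma poly_val_split:
  assumes "rational_poly p" and w: "\<And>j. w j \<in> carrier A"
  shows "poly_val A w p = code_val A w (rest_code p) \<oplus> gaussian_val (const_code p) \<odot> \<one>"
proof -
  let ?c = "Poly_Mapping.lookup p []"
  have "word_val A w u \<in> carrier A" for u
    using w one by (intro word_val_in) auto
  then have "poly_val A w (poly_of (rest_code p) + Poly_Mapping.single [] ?c) =
      poly_val A w (poly_of (rest_code p)) \<oplus> poly_val A w (Poly_Mapping.single [] ?c)"
    by (intro poly_val_add)
  moreover have "poly_of (rest_code p) + Poly_Mapping.single [] ?c = p"
    by (simp add: rest_code[OF assms(1)])
  ultimately show ?thesis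
    using one by (simp add: poly_val_poly_of[OF w] poly_val_single const_code[OF assms(1)])
qed

section \<open>Tuples of rational points and the rational balls of the power\<close>

definition entry :: "nat \<Rightarrow> nat \<Rightarrow> poly_code" where
  "entry m j = dec (e m j)"

lemma cmp_entry [cmp_intros]: "cmp F \<Longrightarrow> cmp G \<Longrightarrow> cmp (\<lambda>x. entry (F x) (G x))"
  using tuple_enum unfolding entry_def computable_tuple_enum_def
  by (intro cmp_intros cmp_computable2[of e]) auto

text \<open>A search through all \<open>m\<close> therefore meets every tuple of rational points, up
  to the irrelevant entries from \<open>N\<close> on.\<close>

lemma entries_surj: "\<exists>m. \<forall>j<N. entry m j = Q j"
proof -
  have "(\<lambda>j\<in>{..<N}. enc (Q j)) \<in> range (\<lambda>m. \<lambda>j\<in>{..<N}. e m j)"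
    using tuple_enum by (simp add: computable_tuple_enum_def bij_betw_def)
  then obtain m where m: "(\<lambda>j\<in>{..<N}. enc (Q j)) = (\<lambda>j\<in>{..<N}. e m j)" by auto
  have "e m j = enc (Q j)" if "j < N" for j
    using fun_cong[OF m, of j] that by simp
  then show ?thesis by (intro exI[of _ m]) (simp add: entry_def)
qed

abbreviation tuples :: "nat \<Rightarrow> nat \<Rightarrow> 'a" where "tuples \<equiv> power_presentation A s N e"

lemma tuples_eq: "j < N \<Longrightarrow> tuples m j = val (entry m j)"
  by (simp add: power_presentation_def rational_point_code s entry_def)

lemma tuples_in: "tuples m \<in> carrier P"
  by (auto simp: power_presentation_def rational_point_code s)

text \<open>Special points of the power are tuples, so a coordinate of a *-polynomial in them arises
  by substituting the codes of their entries in that coordinate.\<close>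

definition centre :: "poly_code \<Rightarrow> nat \<Rightarrow> poly_code" where
  "centre Q j = code_subst (\<lambda>m. entry m j) Q"

lemma rational_point_power:
  "rational_point P tuples n \<in> carrier P"
  "j < N \<Longrightarrow> rational_point P tuples n j = val (centre (dec n) j)"
proof -
  have 0: "Poly_Mapping.lookup (poly_decode n) [] = 0"
    using range_poly_decode by (metis (mono_tags, lifting) mem_Collect_eq rangeI)
  show "rational_point P tuples n \<in> carrier P"
    unfolding rational_point_def using 0 N_pos by (intro poly_val_coord(2)[of _ _ 0] tuples_in) auto
  assume j: "j < N"
  have "rational_point P tuples n j = rational_point A (\<lambda>m. tuples m j) n"
    unfolding rational_point_def by (rule poly_val_coord(1)[OF tuples_in 0 j])
  also have "\<dots> = code_val A (\<lambda>m. val (entry m j)) (dec n)"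
    using j by (simp add: tuples_eq rational_point_code)
  finally show "rational_point P tuples n j = val (centre (dec n) j)"
    by (simp add: centre_def code_val_subst s)
qed

abbreviation ball_code :: "nat \<Rightarrow> poly_code \<times> rat_code" where "ball_code \<equiv> dec"

text \<open>Nonpositive radii are covered too: there is at least one coordinate, and no norm lies
  below such a radius.\<close>

lemma rational_ball_power:
  "z \<in> rational_ball P tuples i \<longleftrightarrow> z \<in> carrier P \<and>
    (\<forall>j<N. cnorm A (val (centre (fst (ball_code i)) j) \<ominus> z j) < real_of_rat (rat_val (snd (ball_code i))))"
proof -
  interpret PN: normed_group P by (rule normed_group_P)
  interpret M: Metric_space "carrier P" "cdist P" by (rule PN.metric)
  obtain n r where i: "prod_decode i = (n, r)" by force
  have d: "ball_code i = (dec n, dec r)"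
    by (simp add: dec_prod_def i)
  have "z \<in> rational_ball P tuples i \<longleftrightarrow> z \<in> carrier P \<and>
      cdist P (rational_point P tuples n) z < real_of_rat (rat_decode r)"
    unfolding rational_ball_def i prod.case M.in_mball using rational_point_power(1) by auto
  also have "\<dots> \<longleftrightarrow> z \<in> carrier P \<and> (\<forall>j<N. cnorm A (val (centre (dec n) j) \<ominus> z j) < real_of_rat (rat_decode r))"
    using rational_point_power by (auto simp: cdist_P_less_iff simp del: P_simps)
  finally show ?thesis by (simp only: d fst_conv snd_conv rat_decode_eq)
qed

text \<open>A rational point that replaces the value of \<open>p\<close> at the \<open>m\<close>-th
  tuple: in it the unit is exchanged for its \<open>M\<close>-th approximation.\<close>

definition relation_code :: "star_poly \<Rightarrow> nat \<Rightarrow> nat \<Rightarrow> poly_code" where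
  "relation_code p m M =
    code_subst (entry m) (rest_code p) @ code_smult (const_code p) (unit_approx M)"

text \<open>Rounding up to a natural number makes the error bound
  \<open>unit_error p / 2 ^ M\<close> the value of a \<open>dyadic\<close> code.\<close>

definition unit_error :: "star_poly \<Rightarrow> nat" where
  "unit_error p = nat \<lceil>cmod (gaussian_val (const_code p)) * cnorm A \<one>\<rceil>"

lemma relation_code_error:
  assumes "rational_poly p"
  shows "cnorm A (val (relation_code p m M) \<ominus> poly_val A (\<lambda>j. val (entry m j)) p) \<le>
    real (unit_error p) / 2 ^ M"
proof -
  let ?c = "gaussian_val (const_code p)" and ?u = "val (unit_approx M)"
    and ?q = "val (code_subst (entry m) (rest_code p))"
  have "poly_val A (\<lambda>j. val (entry m j)) p = ?q \<oplus> ?c \<odot> \<one>"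
    using poly_val_split[OF assms, of "\<lambda>j. val (entry m j)"] by (simp add: code_val_subst s)
  moreover have "val (relation_code p m M) = ?q \<oplus> ?c \<odot> ?u"
    by (simp add: relation_code_def code_val_append code_val_smult s)
  moreover have "(?q \<oplus> ?c \<odot> ?u) \<ominus> (?q \<oplus> ?c \<odot> \<one>) = ?c \<odot> (?u \<ominus> \<one>)"
  proof -
    have "(?q \<oplus> ?c \<odot> ?u) \<ominus> (?q \<oplus> ?c \<odot> \<one>) = (?q \<oplus> \<ominus> ?q) \<oplus> (?c \<odot> ?u \<oplus> \<ominus> (?c \<odot> \<one>))"
      using one by (simp add: a_minus_def minus_add a_ac del: r_neg)
    also have "\<dots> = ?c \<odot> ?u \<oplus> \<ominus> (?c \<odot> \<one>)"
      using one by (simp add: r_neg)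
    also have "\<dots> = ?c \<odot> (?u \<ominus> \<one>)"
      using one by (simp add: a_minus_def smult_add_right smult_m1[symmetric] smult_smult)
    finally show ?thesis .
  qed
  ultimately have "cnorm A (val (relation_code p m M) \<ominus> poly_val A (\<lambda>j. val (entry m j)) p) =
      cmod ?c * cnorm A (?u \<ominus> \<one>)"
    using one by (simp add: cnorm_smult)
  also have "\<dots> \<le> cmod ?c * (cnorm A \<one> / 2 ^ M)"
    by (intro mult_left_mono unit_approx_bound) simp
  also have "\<dots> \<le> real (unit_error p) / 2 ^ M"
  proof -
    have "cmod ?c * cnorm A \<one> \<le> real (unit_error p)"
      unfolding unit_error_def by (rule real_nat_ceiling_ge)
    then show ?thesis by (simp add: divide_right_mono)
  qed
  finally show ?thesis .
qed

text \<open>In \<open>(k, m, M, l)\<close> the number \<open>m\<close> selects a tuple,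
  \<open>M\<close> the approximation of the unit and \<open>l\<close> the stage of the norm
  approximations. The same \<open>k\<close> shrinks the ball by \<open>1 / 2 ^ k\<close> and fixes
  the tolerance \<open>1 / 2 ^ g k\<close> of the relations, as weak stability couples the
  two.\<close>

definition witness :: "nat \<Rightarrow> nat \<times> nat \<times> nat \<times> nat \<Rightarrow> bool" where
  "witness i t = (case t of (k, m, M, l) \<Rightarrow>
    (\<forall>j\<in>{..<N}. rat_val (rat_add (upper (centre (fst (ball_code i)) j @
        code_smult ((- 1, 0), (0, 0)) (entry m j)) l) (dyadic 1 k)) < rat_val (snd (ball_code i))) \<and>
    (\<forall>p\<in>set (polys R). rat_val (rat_add (upper (relation_code p m M) l) (dyadic (unit_error p) M)) <
        rat_val (dyadic 1 (g k))) \<and>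
    (\<forall>j\<in>{..<N}. rat_val (upper (entry m j) l) <
        rat_val (rat_add (dyadic (bounds R j) 0) (dyadic 1 (g k)))))"

lemma cmpp_witness: "cmpp (\<lambda>p. witness (fst p) (snd p))"
  unfolding witness_def case_prod_beta relation_code_def centre_def
  by (intro cmpp_conj cmpp_ball finite_lessThan finite_set cmp_intros cmp_computable[OF computable_g])

lemma witness_iff:
  "witness i (k, m, M, l) \<longleftrightarrow>
    (\<forall>j<N. real_of_rat (rat_val (upper (centre (fst (ball_code i)) j @
        code_smult ((- 1, 0), (0, 0)) (entry m j)) l)) + 1 / 2 ^ k < real_of_rat (rat_val (snd (ball_code i)))) \<and>
    (\<forall>p\<in>set (polys R). real_of_rat (rat_val (upper (relation_code p m M) l)) +
        real (unit_error p) / 2 ^ M < 1 / 2 ^ g k) \<and>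
    (\<forall>j<N. real_of_rat (rat_val (upper (entry m j) l)) < real (bounds R j) + 1 / 2 ^ g k)"
  unfolding witness_def prod.case
  by (simp add: of_rat_less[where 'a = real, symmetric] of_rat_add rat_val_dyadic Ball_def)

section \<open>Soundness and completeness of the search\<close>

lemma val_minus: "val (Q @ code_smult ((- 1, 0), (0, 0)) Q') = val Q \<ominus> val Q'"
proof -
  have "gaussian_val ((- 1, 0), 0, 0) = - 1"
    by (simp add: gaussian_val_def rat_val_def complex_eq_iff)
  then show ?thesis by (simp add: code_val_append code_val_smult s minus_smult)
qed

lemma relationD: "p \<in> set (polys R) \<Longrightarrow> rational_poly p"
  "p \<in> set (polys R) \<Longrightarrow> j \<in> poly_vars p \<Longrightarrow> j < N"
  using relation_set nvars by (auto simp: relation_set_def)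

text \<open>All approximations in the test bound the true norms from above, and the summand
  \<open>dyadic 1 k\<close> reserves the room needed for moving from the tuple to an exact
  solution.\<close>

lemma witness_sound:
  assumes "witness i (k, m, M, l)"
  shows "rational_ball P tuples i \<inter> solutions A R \<noteq> {}"
proof -
  note w = assms[unfolded witness_iff]
  let ?w = "\<lambda>j. val (entry m j)"
  define v where "v = restrict ?w {..<N}"
  have v: "v \<in> {..<nvars R} \<rightarrow>\<^sub>E carrier A" by (auto simp: v_def nvars)
  have "cnorm A (poly_val A v p) < 1 / 2 ^ g k" if p: "p \<in> set (polys R)" for p
  proof -
    \<comment> \<open>\<open>v\<close> and \<open>?w\<close> agree on the variables of
      \<open>p\<close>; the homomorphism is the identity.\<close>
    have "poly_val A v p = poly_val A ?w p" "poly_val A v p \<in> carrier A"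
      using poly_val_hom[of A A "\<lambda>x. x" p ?w v] relationD[OF p] one star_structure_axioms
      by (auto simp: v_def)
    then have "cnorm A (poly_val A v p) \<le> cnorm A (poly_val A ?w p \<ominus> val (relation_code p m M)) +
        cnorm A (val (relation_code p m M))"
      using norm_le_minus[of "poly_val A v p" "val (relation_code p m M)"] by simp
    also have "\<dots> \<le> real (unit_error p) / 2 ^ M + real_of_rat (rat_val (upper (relation_code p m M) l))"
      using relation_code_error[OF relationD(1)[OF p], of m M] cnorm_le_upper
        minus_commute_norm[of "poly_val A ?w p" "val (relation_code p m M)"]
        \<open>poly_val A v p = poly_val A ?w p\<close> \<open>poly_val A v p \<in> carrier A\<close>
      by (intro add_mono) simp_all
    also have "\<dots> < 1 / 2 ^ g k"
      using w p by (auto simp: add.commute)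
    finally show ?thesis .
  qed
  moreover have "cnorm A (v j) - real (bounds R j) < 1 / 2 ^ g k" if "j < N" for j
    using w that cnorm_le_upper[of "entry m j" l] by (force simp: v_def)
  ultimately have "defect A R v < 1 / 2 ^ g k"
    unfolding defect_def nvars using nonempty by (subst Max_less_iff) auto
  moreover obtain \<phi> :: "'a \<Rightarrow> nat \<Rightarrow> nat" where "inj_on \<phi> (carrier A)"
    using separable_inj[OF presentation] .
  ultimately obtain z where z: "z \<in> {..<nvars R} \<rightarrow>\<^sub>E carrier A" "satisfies A R z"
    "\<And>j. j < nvars R \<Longrightarrow> cnorm A (v j \<ominus> z j) < 1 / 2 ^ k"
    using weak_stability_transfer[OF cstar_algebra_axioms monoid _ relation_set modulus v] by blast
  have "cnorm A (val (centre (fst (ball_code i)) j) \<ominus> z j) < real_of_rat (rat_val (snd (ball_code i)))"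
    if j: "j < N" for j
  proof -
    have zj: "z j \<in> carrier A" using z(1) j by (auto simp: nvars)
    have "cnorm A (val (centre (fst (ball_code i)) j) \<ominus> z j) \<le>
        cnorm A (val (centre (fst (ball_code i)) j) \<ominus> ?w j) + cnorm A (?w j \<ominus> z j)"
      using zj by (intro norm_minus_triangle) simp_all
    also have "\<dots> < real_of_rat (rat_val (upper (centre (fst (ball_code i)) j @
        code_smult ((- 1, 0), (0, 0)) (entry m j)) l)) + 1 / 2 ^ k"
      using z(3)[of j] j cnorm_le_upper by (intro add_le_less_mono) (simp_all add: nvars v_def val_minus[symmetric])
    also have "\<dots> < real_of_rat (rat_val (snd (ball_code i)))" using w j by blast
    finally show ?thesis .
  qed
  then have "z \<in> rational_ball P tuples i"
    using z(1) by (simp add: rational_ball_power nvars)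
  moreover have "z \<in> solutions A R" using z by (simp add: solutions_def)
  ultimately show ?thesis by blast
qed

text \<open>The parameters are chosen in the order \<open>k\<close>, tuple, \<open>M\<close>,
  \<open>l\<close>: each threshold depends on the earlier choices, and each choice keeps the
  inequalities strict, leaving slack for the next.\<close>

lemma witness_complete:
  assumes "z \<in> rational_ball P tuples i" "z \<in> solutions A R"
  shows "\<exists>t. witness i t"
proof -
  define c where "c j = val (centre (fst (ball_code i)) j)" for j
  define \<rho> where "\<rho> = real_of_rat (rat_val (snd (ball_code i)))"
  have c: "c j \<in> carrier A" for j by (simp add: c_def)
  have z: "z j \<in> carrier A" if "j < N" for j
    using assms(2) that by (auto simp: solutions_def nvars)
  have near: "cnorm A (c j \<ominus> z j) < \<rho>" if "j < N" for j
    using assms(1) that by (simp add: rational_ball_power c_def \<rho>_def)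
  have sat: "satisfies A R z" using assms(2) by (simp add: solutions_def)

  \<comment> \<open>The solution lies strictly inside the ball, and \<open>1 / 2 ^ k\<close> must
    fit into the slack of every coordinate. This also settles the tolerance
    \<open>1 / 2 ^ g k\<close>.\<close>
  have "\<forall>\<^sub>F k in sequentially. \<forall>j\<in>{..<N}. cnorm A (c j \<ominus> z j) + 1 / 2 ^ k < \<rho>"
    using near tendsto_add[OF tendsto_const half_power_limit[of 1]]
    by (intro eventually_ball_less[where a = "\<lambda>j. cnorm A (c j \<ominus> z j) + 0"]) auto
  then obtain k where k: "\<And>j. j < N \<Longrightarrow> cnorm A (c j \<ominus> z j) + 1 / 2 ^ k < \<rho>"
    by (auto simp: eventually_sequentially)

  \<comment> \<open>The guard \<open>j < N\<close> makes the statement true for all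
    \<open>j\<close>, so that a choice function on all of \<open>nat\<close> exists.\<close>
  have "\<exists>Q. j < N \<longrightarrow> conv (\<lambda>n. val (Q n)) (z j)" for j
    using dense_codes[OF presentation z, of j] by blast
  then have "\<forall>j. \<exists>Q. j < N \<longrightarrow> conv (\<lambda>n. val (Q n)) (z j)" ..
  from choice[OF this] obtain Q where Q: "\<forall>j. j < N \<longrightarrow> conv (\<lambda>n. val (Q j n)) (z j)" ..
  have "\<forall>n. \<exists>m. \<forall>j<N. entry m j = Q j n"
    using entries_surj by (rule allI)
  from choice[OF this] obtain m where "\<forall>n. \<forall>j<N. entry (m n) j = Q j n" ..
  then have w: "conv (\<lambda>n. val (entry (m n) j)) (z j)" if "j < N" for j
    using Q that by simp
  have "\<forall>\<^sub>F n in sequentially. \<forall>j\<in>{..<N}. cnorm A (c j \<ominus> val (entry (m n) j)) < \<rho> - 1 / 2 ^ k"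
  proof (rule eventually_ball_less)
    fix j assume "j \<in> {..<N}"
    then have j: "j < N" by simp
    have "conv (\<lambda>n. c j \<oplus> (- 1) \<odot> val (entry (m n) j)) (c j \<oplus> (- 1) \<odot> z j)"
      by (intro conv_add conv_smult conv_const tendsto_const w j c)
    from conv_norm[OF this]
    show "(\<lambda>n. cnorm A (c j \<ominus> val (entry (m n) j))) \<longlonglongrightarrow> cnorm A (c j \<ominus> z j)"
      using c z[OF j] by (simp add: minus_smult)
    show "cnorm A (c j \<ominus> z j) < \<rho> - 1 / 2 ^ k" using k[OF j] by simp
  qed simp
  moreover have "\<forall>\<^sub>F n in sequentially. \<forall>p\<in>set (polys R).
      cnorm A (poly_val A (\<lambda>j. val (entry (m n) j)) p) < 1 / 2 ^ g k"
  proof (rule eventually_ball_less)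
    fix p assume p: "p \<in> set (polys R)"
    show "(\<lambda>n. cnorm A (poly_val A (\<lambda>j. val (entry (m n) j)) p)) \<longlonglongrightarrow> cnorm A (poly_val A z p)"
      by (intro conv_norm conv_poly_val w relationD[OF p] one)
    show "cnorm A (poly_val A z p) < 1 / 2 ^ g k" using sat p by (simp add: satisfies_def)
  qed simp
  moreover have "\<forall>\<^sub>F n in sequentially. \<forall>j\<in>{..<N}.
      cnorm A (val (entry (m n) j)) < real (bounds R j) + 1 / 2 ^ g k"
  proof (rule eventually_ball_less)
    fix j assume "j \<in> {..<N}"
    then have j: "j < N" by simp
    show "(\<lambda>n. cnorm A (val (entry (m n) j))) \<longlonglongrightarrow> cnorm A (z j)"
      by (intro conv_norm w j)
    have "cnorm A (z j) \<le> real (bounds R j)" using sat j by (simp add: satisfies_def nvars)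
    then show "cnorm A (z j) < real (bounds R j) + 1 / 2 ^ g k"
      by (rule order_le_less_trans) simp
  qed simp
  ultimately have "\<forall>\<^sub>F n in sequentially.
      (\<forall>j\<in>{..<N}. cnorm A (c j \<ominus> val (entry (m n) j)) < \<rho> - 1 / 2 ^ k) \<and>
      (\<forall>p\<in>set (polys R). cnorm A (poly_val A (\<lambda>j. val (entry (m n) j)) p) < 1 / 2 ^ g k) \<and>
      (\<forall>j\<in>{..<N}. cnorm A (val (entry (m n) j)) < real (bounds R j) + 1 / 2 ^ g k)"
    by (intro eventually_conj)
  then obtain n where n: "\<forall>j\<in>{..<N}. cnorm A (c j \<ominus> val (entry n j)) < \<rho> - 1 / 2 ^ k"
    "\<forall>p\<in>set (polys R). cnorm A (poly_val A (\<lambda>j. val (entry n j)) p) < 1 / 2 ^ g k"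
    "\<forall>j\<in>{..<N}. cnorm A (val (entry n j)) < real (bounds R j) + 1 / 2 ^ g k"
    using eventually_happens'[OF sequentially_bot] by blast

  \<comment> \<open>With the tuple fixed, the codes converge to the exact values of the relations
    and the error allowance tends to 0, so the sum of the two stays below the threshold.\<close>
  have "\<forall>\<^sub>F M in sequentially. \<forall>p\<in>set (polys R).
      cnorm A (val (relation_code p n M)) + real (unit_error p) / 2 ^ M < 1 / 2 ^ g k"
  proof (rule eventually_ball_less)
    fix p assume p: "p \<in> set (polys R)"
    have "poly_val A (\<lambda>j. val (entry n j)) p \<in> carrier A"
      using poly_val_split[OF relationD(1)[OF p], of "\<lambda>j. val (entry n j)"] one
      by (simp add: code_val_in)
    then have "conv (\<lambda>M. val (relation_code p n M)) (poly_val A (\<lambda>j. val (entry n j)) p)"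
      by (intro convI[OF _ _ relation_code_error[OF relationD(1)[OF p]] half_power_limit]) simp_all
    from tendsto_add[OF conv_norm[OF this] half_power_limit]
    show "(\<lambda>M. cnorm A (val (relation_code p n M)) + real (unit_error p) / 2 ^ M) \<longlonglongrightarrow>
        cnorm A (poly_val A (\<lambda>j. val (entry n j)) p) + 0" .
    show "cnorm A (poly_val A (\<lambda>j. val (entry n j)) p) + 0 < 1 / 2 ^ g k" using n(2) p by simp
  qed simp
  then obtain M where M: "\<forall>p\<in>set (polys R).
      cnorm A (val (relation_code p n M)) + real (unit_error p) / 2 ^ M < 1 / 2 ^ g k"
    using eventually_happens'[OF sequentially_bot] by blast

  \<comment> \<open>What remains are finitely many norms of fixed rational points, each strictly
    below its threshold; one stage \<open>l\<close> serves for all.\<close>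
  have "\<forall>\<^sub>F l in sequentially. \<forall>j\<in>{..<N}. real_of_rat (rat_val (upper (centre (fst (ball_code i)) j @
      code_smult ((- 1, 0), (0, 0)) (entry n j)) l)) < \<rho> - 1 / 2 ^ k"
    by (rule eventually_ball_less[OF finite_lessThan upper_limit]) (use n(1) in \<open>simp add: val_minus c_def\<close>)
  moreover have "\<forall>\<^sub>F l in sequentially. \<forall>p\<in>set (polys R).
      real_of_rat (rat_val (upper (relation_code p n M) l)) < 1 / 2 ^ g k - real (unit_error p) / 2 ^ M"
    by (rule eventually_ball_less[OF finite_set upper_limit]) (use M in \<open>simp add: less_diff_eq\<close>)
  moreover have "\<forall>\<^sub>F l in sequentially. \<forall>j\<in>{..<N}.
      real_of_rat (rat_val (upper (entry n j) l)) < real (bounds R j) + 1 / 2 ^ g k"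
    by (rule eventually_ball_less[OF finite_lessThan upper_limit]) (use n(3) in simp)
  ultimately have "\<forall>\<^sub>F l in sequentially. witness i (k, n, M, l)"
    by eventually_elim (auto simp: witness_iff \<rho>_def less_diff_eq)
  then show ?thesis
    using eventually_happens'[OF sequentially_bot] by blast
qed

lemma ce_closed_solutions: "ce_closed P tuples (solutions A R)"
proof -
  have "{i. rational_ball P tuples i \<inter> solutions A R \<noteq> {}} = {i. \<exists>t. witness i t}"
    using witness_sound witness_complete by fastforce
  then show ?thesis
    using ce_setI[OF cmpp_witness] closedin_solutions[OF relation_set nvars monoid]
    by (simp only: ce_closed_def)
qed

end

theorem theorem1p12:
  fixes A :: "'a cstar" and s :: "nat \<Rightarrow> 'a" and R :: star_relations
    and N :: nat and e :: "nat \<Rightarrow> nat \<Rightarrow> nat"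
  assumes "cstar_algebra A" and "Group.monoid A"
    and "ce_presentation A s"
    and "relation_set R" and "nvars R = N"
    and "computably_weakly_stable R"
    and "computable_tuple_enum N e"
  shows "ce_closed (power_algebra A N) (power_presentation A s N e) (solutions A R)"
proof -
  obtain f where "computable2 f" "\<And>n. decseq (\<lambda>k. rat_decode (f n k))"
    "\<And>n. (\<lambda>k. real_of_rat (rat_decode (f n k))) \<longlonglongrightarrow> cnorm A (rational_point A s n)"
    using assms(3) unfolding ce_presentation_def by blast
  moreover obtain g where "computable g" "weak_stability_modulus R g"
    using assms(6) unfolding computably_weakly_stable_def by blast
  moreover have "presentation A s" "1 \<le> N"
    using assms(3-5) by (auto simp: ce_presentation_def relation_set_def)
  ultimately interpret ce_setting A N s R e f g
    using assms by (intro ce_setting.intro cstar_power.intro cstar_power_axioms.intro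
        ce_setting_axioms.intro) auto
  show ?thesis by (rule ce_closed_solutions)
qed

end
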